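(* Let $\mathbb{X}$ be a Borel subset of some Polish space, metrized by a totally bounded distance $\mathrm{d}'_{\mathbb{X}}$ (generating its topology). Let $[[\mathbb{X}]]$ and $[\mathbb{X}^m]$ be endowed with the metrics $\mathrm{d}^{(W)}_{[[\mathbb{X}]]}$ and $\mathrm{d}^{(W)}_{[\mathbb{X}^m]}$ respectively, defined in the context. Let $q$ be a probability measure on $([\mathbb{X}],\mathscr{B}([\mathbb{X}]))$ and let $\rho$ be the exchangeable probability measure on $(\mathbb{X}^\infty,\mathscr{B}(\mathbb{X}^\infty))$ given by $\rho(C)=\int_{[\mathbb{X}]}\mathfrak{p}^\infty(C)\,q(\mathrm{d}\mathfrak{p})$ for $C\in\mathscr{B}(\mathbb{X}^\infty)$. Then $$\limsup_{n\to\infty}\sqrt{\frac{n}{\log\log n}}\;\mathrm{d}^{(W)}_{[[\mathbb{X}]]}\big(q(\tilde{\boldsymbol{\xi}}^{(n)}),\delta_{\tilde{\mathfrak{e}}_n}\big)\le\sqrt2\qquad(\rho\text{-a.s.})$$ and, for every $m\in\mathbb{N}$, $$\limsup_{n\to\infty}\sqrt{\frac{n}{\log\log n}}\;\mathrm{d}^{(W)}_{[\mathbb{X}^m]}\big(p_m(\tilde{\boldsymbol{\xi}}^{(n)}),\tilde{\mathfrak{e}}_n^m\big)\le\sqrt2\,m\qquad(\rho\text{-a.s.}).$$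
   Context: For a separable metrizable space $\mathbb{S}$ with Borel $\sigma$-algebra $\mathscr{B}(\mathbb{S})$, $[\mathbb{S}]$ denotes the set of all probability measures on $(\mathbb{S},\mathscr{B}(\mathbb{S}))$, endowed with the topology of weak convergence and its Borel $\sigma$-algebra; $[[\mathbb{S}]]$ is the set of probability measures on $[\mathbb{S}]$. $\mathfrak{p}^m$ is the $m$-fold product measure. $\tilde{\xi}_1,\tilde{\xi}_2,\dots$ are the coordinate random elements of $\mathbb{X}^\infty$ and $\tilde{\boldsymbol{\xi}}^{(n)}:=(\tilde{\xi}_1,\dots,\tilde{\xi}_n)$. The empirical measure is $\tilde{\mathfrak{e}}_n:=\frac1n\sum_{i=1}^n\delta_{\tilde{\xi}_i}$, and $\delta_{\tilde{\mathfrak{e}}_n}\in[[\mathbb{X}]]$ is the point mass at $\tilde{\mathfrak{e}}_n$. Under $\rho$ there is a random probability measure $\tilde{\mathfrak{p}}$ ($\mathscr{B}(\mathbb{X}^\infty)/\mathscr{B}([\mathbb{X}])$-measurable, $\rho$-a.s. unique) with distribution $q$ such that $\tilde{\mathfrak{e}}_n$ converges weakly to $\tilde{\mathfrak{p}}$, $\rho$-a.s. The posterior distribution $q(\tilde{\boldsymbol{\xi}}^{(n)})=q(\tilde{\boldsymbol{\xi}}^{(n)},\cdot)$ is a (fixed) regular conditional distribution of $\tilde{\mathfrak{p}}$ given $\tilde{\boldsymbol{\xi}}^{(n)}$ under $\rho$. The predictive distribution is $p_m(\tilde{\boldsymbol{\xi}}^{(n)},C):=\int_{[\mathbb{X}]}\mathfrak{p}^m(C)\,q(\tilde{\boldsymbol{\xi}}^{(n)},\mathrm{d}\mathfrak{p})$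 for $C\in\mathscr{B}(\mathbb{X}^m)$. Metrics. Fix a countable family $\{g_k\}_{k\ge1}$ of $\mathrm{d}'_{\mathbb{X}}$-Lipschitz continuous, $[0,1]$-valued functions on $\mathbb{X}$ which is a determining class for weak convergence in $[\mathbb{X}]$ and is dense, in the sup norm, in the space of $\mathrm{d}'_{\mathbb{X}}$-uniformly continuous $[0,1]$-valued functions (such a family exists). Put $\|g\|_{BL}:=\sup_x|g(x)|+\sup_{x\ne y}|g(x)-g(y)|/\mathrm{d}'_{\mathbb{X}}(x,y)$ and $g_k^*:=g_k/\|g_k\|_{BL}$ (with $g_k^*:=0$ if $g_k\equiv0$). Define on $[\mathbb{X}]$ $$\mathrm{d}^{(W)}_{[\mathbb{X}]}(\mu_1,\mu_2):=\sum_{k=1}^\infty\frac1{2^k}\Big|\int_{\mathbb{X}}g_k^*\,\mathrm{d}\mu_1-\int_{\mathbb{X}}g_k^*\,\mathrm{d}\mu_2\Big|.$$ Repeat the same construction with $(\mathbb{X},\mathrm{d}'_{\mathbb{X}})$ replaced by $([\mathbb{X}],\mathrm{d}^{(W)}_{[\mathbb{X}]})$: with a countable family $\{h_k\}_{k\ge1}$ of $\mathrm{d}^{(W)}_{[\mathbb{X}]}$-Lipschitz, $[0,1]$-valued functions on $[\mathbb{X}]$ having the analogous properties, and $h_k^*:=h_k/\|h_k\|_{BL}$ (with the norm $\|\cdot\|_{BL}$ computed with respect to $\mathrm{d}^{(W)}_{[\mathbb{X}]}$, and $h_k^*:=0$ if $h_k\equiv 0$), define on $[[\mathbb{X}]]$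 $$\mathrm{d}^{(W)}_{[[\mathbb{X}]]}(Q_1,Q_2):=\sum_{k=1}^\infty\frac1{2^k}\Big|\int_{[\mathbb{X}]}h_k^*\,\mathrm{d}Q_1-\int_{[\mathbb{X}]}h_k^*\,\mathrm{d}Q_2\Big|.$$ Finally, on $[\mathbb{X}^m]$, $$\mathrm{d}^{(W)}_{[\mathbb{X}^m]}(\nu_1,\nu_2):=\sum_{k_1,\dots,k_m\in\mathbb{N}}\frac1{2^{k_1+\dots+k_m}}\Big|\int_{\mathbb{X}^m}\prod_{i=1}^m g_{k_i}^*(x_i)\,\nu_1(\mathrm{d}x)-\int_{\mathbb{X}^m}\prod_{i=1}^m g_{k_i}^*(x_i)\,\nu_2(\mathrm{d}x)\Big|,$$ with $\mathbb{N}=\{1,2,\dots\}$. *)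

theory Defs
  imports "HOL-Probability.Probability"
begin

definition borel_of :: "'a topology \<Rightarrow> 'a measure" where
  "borel_of T = sigma (topspace T) {U. openin T U}"

definition weak_topology :: "'a topology \<Rightarrow> 'a measure topology" where
  "weak_topology T = topology_generated_by
     {{\<mu> \<in> space (prob_algebra (borel_of T)). (\<integral>x. f x \<partial>\<mu>) \<in> U} | f U.
        continuous_map T euclideanreal f \<and> bounded (f ` topspace T) \<and> open U}"

definition lipschitz_wrt :: "'a set \<Rightarrow> ('a \<Rightarrow> 'a \<Rightarrow> real) \<Rightarrow> ('a \<Rightarrow> real) \<Rightarrow> bool" where
  "lipschitz_wrt S d f \<longleftrightarrow> (\<exists>L. \<forall>x\<in>S. \<forall>y\<in>S. \<bar>f x - f y\<bar> \<le> L * d x y)"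

definition uniformly_continuous_wrt :: "'a set \<Rightarrow> ('a \<Rightarrow> 'a \<Rightarrow> real) \<Rightarrow> ('a \<Rightarrow> real) \<Rightarrow> bool" where
  "uniformly_continuous_wrt S d f \<longleftrightarrow>
     (\<forall>\<epsilon>>0. \<exists>\<delta>>0. \<forall>x\<in>S. \<forall>y\<in>S. d x y < \<delta> \<longrightarrow> \<bar>f x - f y\<bar> < \<epsilon>)"

text \<open>Families are indexed by \<open>k \<ge> 1\<close>; the value at \<open>k = 0\<close> is never used.\<close>

definition convergence_determining :: "'a topology \<Rightarrow> (nat \<Rightarrow> 'a \<Rightarrow> real) \<Rightarrow> bool" where
  "convergence_determining T g \<longleftrightarrow>
     (\<forall>\<mu>s \<mu>. range \<mu>s \<subseteq> space (prob_algebra (borel_of T)) \<longrightarrow>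
        \<mu> \<in> space (prob_algebra (borel_of T)) \<longrightarrow>
        (limitin (weak_topology T) \<mu>s \<mu> sequentially \<longleftrightarrow>
          (\<forall>k\<ge>1. (\<lambda>n. \<integral>x. g k x \<partial>\<mu>s n) \<longlonglongrightarrow> (\<integral>x. g k x \<partial>\<mu>))))"

definition admissible_family ::
  "'a topology \<Rightarrow> ('a \<Rightarrow> 'a \<Rightarrow> real) \<Rightarrow> (nat \<Rightarrow> 'a \<Rightarrow> real) \<Rightarrow> bool" where
  "admissible_family T d g \<longleftrightarrow>
     (\<forall>k\<ge>1. g k \<in> topspace T \<rightarrow> {0..1} \<and> lipschitz_wrt (topspace T) d (g k)) \<and>
     convergence_determining T g \<and>
     (\<forall>f. f \<in> topspace T \<rightarrow> {0..1} \<longrightarrow> uniformly_continuous_wrt (topspace T) d f \<longrightarrow>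
        (\<forall>\<epsilon>>0. \<exists>k\<ge>1. \<forall>x\<in>topspace T. \<bar>f x - g k x\<bar> < \<epsilon>))"

text \<open>The second supremum also runs over the diagonal, where the quotient is \<open>0 / 0 = 0\<close>. This
  does not change its value and makes it \<open>0\<close> when \<open>S\<close> is a singleton.\<close>

definition BL_norm :: "'a set \<Rightarrow> ('a \<Rightarrow> 'a \<Rightarrow> real) \<Rightarrow> ('a \<Rightarrow> real) \<Rightarrow> real" where
  "BL_norm S d f = (SUP x\<in>S. \<bar>f x\<bar>) + (SUP (x, y)\<in>S \<times> S. \<bar>f x - f y\<bar> / d x y)"

text \<open>If \<open>f\<close> vanishes on \<open>S\<close>, the norm is \<open>0\<close> and so is \<open>BL_normalize S d f\<close>, by \<open>x / 0 = 0\<close>.\<close>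

definition BL_normalize :: "'a set \<Rightarrow> ('a \<Rightarrow> 'a \<Rightarrow> real) \<Rightarrow> ('a \<Rightarrow> real) \<Rightarrow> 'a \<Rightarrow> real" where
  "BL_normalize S d f x = f x / BL_norm S d f"

definition weak_dist ::
  "'a topology \<Rightarrow> ('a \<Rightarrow> 'a \<Rightarrow> real) \<Rightarrow> (nat \<Rightarrow> 'a \<Rightarrow> real) \<Rightarrow> 'a measure \<Rightarrow> 'a measure \<Rightarrow> real" where
  "weak_dist T d g \<mu> \<nu> =
     (\<Sum>\<^sub>\<infinity>k\<in>{1..}. 1 / 2 ^ k *
        \<bar>(\<integral>x. BL_normalize (topspace T) d (g k) x \<partial>\<mu>)
         - (\<integral>x. BL_normalize (topspace T) d (g k) x \<partial>\<nu>)\<bar>)"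

text \<open>The \<open>m\<close>-fold power of a space is the product over the index set \<open>{..<m}\<close>.\<close>

definition weak_dist_power ::
  "'a topology \<Rightarrow> ('a \<Rightarrow> 'a \<Rightarrow> real) \<Rightarrow> (nat \<Rightarrow> 'a \<Rightarrow> real) \<Rightarrow> nat \<Rightarrow>
   (nat \<Rightarrow> 'a) measure \<Rightarrow> (nat \<Rightarrow> 'a) measure \<Rightarrow> real" where
  "weak_dist_power T d g m \<mu> \<nu> =
     (\<Sum>\<^sub>\<infinity>k\<in>{..<m} \<rightarrow>\<^sub>E {1..}. 1 / 2 ^ (\<Sum>i<m. k i) *
        \<bar>(\<integral>x. (\<Prod>i<m. BL_normalize (topspace T) d (g (k i)) (x i)) \<partial>\<mu>)
         - (\<integral>x. (\<Prod>i<m. BL_normalize (topspace T) d (g (k i)) (x i)) \<partial>\<nu>)\<bar>)"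

definition iid_mixture :: "'a topology \<Rightarrow> 'i set \<Rightarrow> 'a measure measure \<Rightarrow> ('i \<Rightarrow> 'a) measure" where
  "iid_mixture T I Q =
     measure_of (space (Pi\<^sub>M I (\<lambda>_. borel_of T))) (sets (Pi\<^sub>M I (\<lambda>_. borel_of T)))
       (\<lambda>C. \<integral>\<^sup>+\<pp>. emeasure (Pi\<^sub>M I (\<lambda>_. \<pp>)) C \<partial>Q)"

text \<open>Sequences are indexed from \<open>0\<close>: the sample of size \<open>n\<close> is \<open>(\<omega> 0, \<dots>, \<omega> (n - 1))\<close>.\<close>

definition empirical_measure :: "'a topology \<Rightarrow> nat \<Rightarrow> (nat \<Rightarrow> 'a) \<Rightarrow> 'a measure" where
  "empirical_measure T n \<omega> =
     measure_of (space (borel_of T)) (sets (borel_of T))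
       (\<lambda>A. (\<Sum>i<n. emeasure (return (borel_of T) (\<omega> i)) A) / of_nat n)"

text \<open>\<open>\<kappa>\<close> is a regular conditional distribution of the \<open>N\<close>-valued \<open>V\<close> given the \<open>L\<close>-valued \<open>U\<close>
  under \<open>M\<close>. Measurability into \<^term>\<open>prob_algebra N\<close> says precisely that \<open>\<kappa>\<close> is a Markov kernel.\<close>

definition regular_conditional_distribution ::
  "'w measure \<Rightarrow> 'l measure \<Rightarrow> ('w \<Rightarrow> 'l) \<Rightarrow> 'n measure \<Rightarrow> ('w \<Rightarrow> 'n) \<Rightarrow> ('l \<Rightarrow> 'n measure) \<Rightarrow> bool" where
  "regular_conditional_distribution M L U N V \<kappa> \<longleftrightarrow>
     \<kappa> \<in> L \<rightarrow>\<^sub>M prob_algebra N \<and>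
     (\<forall>A\<in>sets L. \<forall>B\<in>sets N.
        emeasure M (U -` A \<inter> V -` B \<inter> space M) =
          (\<integral>\<^sup>+\<omega>\<in>U -` A \<inter> space M. emeasure (\<kappa> (U \<omega>)) B \<partial>M))"

end

theory Submission
  imports Defs
begin

text \<open>Write \<open>r\<^sub>n = \<Sum>\<^sub>k 2\<^sup>-\<^sup>k E[\<bar>p(g\<^sub>k) - e\<^sub>n(g\<^sub>k)\<bar> | \<xi>\<^sub>1, \<dots>, \<xi>\<^sub>n]\<close> with the normalized \<open>g\<^sub>k\<close>. The functions
  \<open>h\<^sub>k\<close>, once normalized, are 1-Lipschitz for the weak distance, so the first distance is at most \<open>r\<^sub>n\<close>;
  expanding a difference of products bounds the second one by \<open>m r\<^sub>n\<close>.

  Almost surely \<open>n r\<^sub>n \<le> sqrt (2 n log log n)\<close> for large \<open>n\<close>. Indeed, by Jensen, \<open>exp (l n r\<^sub>n)\<close> is at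
  most \<open>A\<^sub>n = \<Sum>\<^sub>k 2\<^sup>-\<^sup>k E[exp (l Y) + exp (- l Y) | \<xi>\<^sub>1, \<dots>, \<xi>\<^sub>n]\<close> with \<open>Y = \<Sum>\<^sub>i\<^sub>\<le>\<^sub>n (g\<^sub>k(\<xi>\<^sub>i) - p(g\<^sub>k))\<close>. As \<open>exp (l Y)\<close> is a
  submartingale given \<open>p\<close>, the \<open>A\<^sub>n\<close> form a submartingale; Doob's inequality over \<open>2\<^sup>j \<le> n \<le> 2\<^sup>j\<^sup>+\<^sup>1\<close> and
  Hoeffding's lemma, with the optimal \<open>l\<close>, bound the probability of an exceedance by \<open>2 / (j log 2)\<^sup>2\<close>.
  The standard deviation of a \<open>[0, 1]\<close>-valued function is at most \<open>1/2\<close>, and the factor 2 between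
  this and the asserted constant pays for the dyadic blocks, so that neither the law of the iterated
  logarithm nor martingale convergence is needed.\<close>

section \<open>Sums of bounded variables under product measures\<close>

text \<open>The centring \<open>p(g\<^sub>k)\<close> is random and unobserved, and the posteriors
  for different \<open>n\<close> are separately chosen versions, so nothing can be compared
  pointwise between sample sizes. Comparisons are therefore made after integrating against a
  function of the first \<open>n\<close> observations: the posterior turns into
  \<open>ptilde\<close>, the law of large numbers identifies the means of \<open>ptilde\<close> with
  those of the mixing law \<open>p\<close>, and given \<open>p\<close> the observations are
  independent. The submartingale property of \<open>A\<^sub>n\<close> is used only in this
  integrated form.

  It relates sums with the same \<open>l\<close>, which is why \<open>l\<close> is chosen once per
  block. With \<open>N = 2\<^sup>j\<^sup>+\<^sup>1\<close> and \<open>L = log log 2\<^sup>j\<close>,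
  the quotient of the moment bound \<open>2 exp (l\<^sup>2 N / 8)\<close> by the level
  \<open>exp (l sqrt (N L))\<close> is smallest at \<open>l = 4 sqrt (L / N)\<close>, where it
  equals \<open>2 exp (- 2 L)\<close>. Off the exceptional events
  \<open>n r\<^sub>n < sqrt (N L)\<close>, and \<open>N \<le> 2 n\<close> puts the 2 under the root.

  The weights \<open>2\<^sup>-\<^sup>k\<close> enter \<open>A\<^sub>n\<close> as a convex
  combination, so infinitely many test functions cost no more than one and no union bound over
  \<open>k\<close> occurs.\<close>

lemma AE_bindD:
  assumes N: "N \<in> M \<rightarrow>\<^sub>M subprob_algebra B" and M: "space M \<noteq> {}"
    and P: "AE y in M \<bind> N. P y"
  shows "AE x in M. AE y in N x. P y"
proof -
  have sB: "sets (M \<bind> N) = sets B" using sets_bind_measurable[OF N M] .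
  \<comment> \<open>\<open>P\<close> may be non-measurable, whereas \<open>AE_bind\<close> speaks of
    measurable predicates; the failures of \<open>P\<close> are therefore enclosed in a measurable
    null set \<open>Z\<close>.\<close>
  obtain Z where Z: "{y \<in> space (M \<bind> N). \<not> P y} \<subseteq> Z" "emeasure (M \<bind> N) Z = 0" "Z \<in> sets (M \<bind> N)"
    using AE_E[OF P] by blast
  have "AE y in M \<bind> N. y \<notin> Z"
    using Z by (intro AE_not_in null_setsI) auto
  moreover have "Measurable.pred B (\<lambda>y. y \<notin> Z)"
    using Z(3) sB by simp
  ultimately have "AE x in M. AE y in N x. y \<notin> Z"
    using AE_bind[OF N] by blast
  moreover have "AE x in M. sets (N x) = sets B"
    using sets_kernel[OF N] by auto
  ultimately show ?thesis
  proof eventually_elim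
    case (elim x)
    have "AE y in N x. y \<in> space (N x)" by simp
    with elim(1) show ?case
    proof eventually_elim
      case (elim y)
      then show ?case
        using Z(1) sets_eq_imp_space_eq[OF sB] sets_eq_imp_space_eq[OF \<open>sets (N x) = sets B\<close>] by auto
    qed
  qed
qed

text \<open>Cylinder sets generate the product sigma-algebra and are stable under intersection, and
  the power of \<open>p\<close> gives a cylinder a finite product of values of \<open>p\<close>,
  which is measurable in \<open>p\<close>. The index set may be infinite.\<close>

lemma measurable_PiM_power:
  "(\<lambda>p. Pi\<^sub>M I (\<lambda>_. p)) \<in> prob_algebra M \<rightarrow>\<^sub>M prob_algebra (Pi\<^sub>M I (\<lambda>_. M))"
proof (rule measurable_prob_algebra_generated[OF sets_PiM Int_stable_prod_algebra prod_algebra_sets_into_space])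
  fix p assume "p \<in> space (prob_algebra M)"
  then have p: "sets p = sets M" "prob_space p" by (auto simp: space_prob_algebra)
  show "prob_space (Pi\<^sub>M I (\<lambda>_. p))" by (intro prob_space_PiM p)
  show "sets (Pi\<^sub>M I (\<lambda>_. p)) = sets (Pi\<^sub>M I (\<lambda>_. M))" by (intro sets_PiM_cong p refl)
next
  fix A assume "A \<in> prod_algebra I (\<lambda>_. M)"
  then obtain J E where A: "A = prod_emb I (\<lambda>_. M) J (\<Pi>\<^sub>E j\<in>J. E j)"
    "finite J" "J \<subseteq> I" "\<And>i. i \<in> J \<Longrightarrow> E i \<in> sets M"
    by (rule prod_algebraE) blast
  have "(\<lambda>p. \<Prod>i\<in>J. emeasure p (E i)) \<in> borel_measurable (prob_algebra M)"
    using A(4) unfolding prob_algebra_def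
    by (intro borel_measurable_prod_ennreal measurable_restrict_space1
        measurable_emeasure_subprob_algebra)
  moreover have "emeasure (Pi\<^sub>M I (\<lambda>_. p)) A = (\<Prod>i\<in>J. emeasure p (E i))"
    if "p \<in> space (prob_algebra M)" for p
  proof -
    have p: "sets p = sets M" "prob_space p" using that by (auto simp: space_prob_algebra)
    have "prod_emb I (\<lambda>_. M) J (\<Pi>\<^sub>E j\<in>J. E j) = prod_emb I (\<lambda>_. p) J (\<Pi>\<^sub>E j\<in>J. E j)"
      using sets_eq_imp_space_eq[OF p(1)] by (simp add: prod_emb_def)
    then show ?thesis
      unfolding A(1) using A p by (auto intro!: emeasure_PiM_emb)
  qed
  ultimately show "(\<lambda>p. emeasure (Pi\<^sub>M I (\<lambda>_. p)) A) \<in> borel_measurable (prob_algebra M)"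
    by (subst measurable_cong) auto
qed

text \<open>\<open>ennreal\<close> cuts off the negative part of \<open>f\<close>, hence an
  inequality. It is applied to tangent lines of the exponential, which may be negative.\<close>

lemma ennreal_integral_le_nn_integral:
  assumes "integrable M f"
  shows "ennreal (\<integral>x. f x \<partial>M) \<le> (\<integral>\<^sup>+x. ennreal (f x) \<partial>M)"
proof -
  have fin: "(\<integral>\<^sup>+x. ennreal (f x) \<partial>M) < \<infinity>"
    using assms real_integrable_def[of M f] by (auto simp: top.not_eq_extremum)
  have "(\<integral>x. f x \<partial>M) \<le> enn2real (\<integral>\<^sup>+x. ennreal (f x) \<partial>M)"
    using real_lebesgue_integral_def[OF assms] by simp
  then have "ennreal (\<integral>x. f x \<partial>M) \<le> ennreal (enn2real (\<integral>\<^sup>+x. ennreal (f x) \<partial>M))"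
    by (rule ennreal_leI)
  with fin show ?thesis by simp
qed

lemma ennreal_suminf_le:
  assumes "summable (\<lambda>k::nat. \<bar>a k\<bar>)"
  shows "ennreal (\<Sum>k. a k) \<le> (\<Sum>k. ennreal (a k))"
  using ennreal_integral_le_nn_integral[of "count_space UNIV" a] assms
  by (simp add: integrable_count_space_nat_iff integral_count_space_nat nn_integral_count_space_nat)

lemma integral_in_unit_interval:
  assumes "prob_space \<mu>" "f \<in> borel_measurable \<mu>" "\<And>x. x \<in> space \<mu> \<Longrightarrow> f x \<in> {0..1::real}"
  shows "integrable \<mu> f" "(\<integral>x. f x \<partial>\<mu>) \<in> {0..1}"
proof -
  interpret prob_space \<mu> by fact
  show i: "integrable \<mu> f" using assms(2,3) by (intro integrable_const_bound[where B = 1]) auto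
  have "(\<integral>x. f x \<partial>\<mu>) \<le> (\<integral>x. 1 \<partial>\<mu>)" using assms(3) i by (intro integral_mono) auto
  moreover have "0 \<le> (\<integral>x. f x \<partial>\<mu>)" using assms(3) by (intro Bochner_Integration.integral_nonneg) auto
  ultimately show "(\<integral>x. f x \<partial>\<mu>) \<in> {0..1}" by (simp add: prob_space)
qed

section \<open>Exponential moments of sums of independent bounded variables\<close>

context prob_space begin

text \<open>Coordinate \<open>n\<close> is independent of the earlier ones: after projection to
  \<open>{..<Suc n}\<close>, Fubini's theorem for a finite product integrates it out and leaves the
  factor that depends on the past.\<close>

lemma nn_integral_PiM_restrict_step:
  assumes u: "u \<in> borel_measurable (Pi\<^sub>M {..<n} (\<lambda>_. M))"
    and f: "f \<in> borel_measurable M"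
  shows "(\<integral>\<^sup>+\<omega>. u (restrict \<omega> {..<n}) * f (\<omega> (n::nat)) \<partial>Pi\<^sub>M UNIV (\<lambda>_. M))
    = (\<integral>\<^sup>+\<omega>. u (restrict \<omega> {..<n}) \<partial>Pi\<^sub>M UNIV (\<lambda>_. M)) * (\<integral>\<^sup>+x. f x \<partial>M)"
proof -
  interpret P: product_prob_space "\<lambda>_::nat. M" UNIV by standard
  note [measurable] = u f
  have R: "distr (Pi\<^sub>M UNIV (\<lambda>_. M)) (Pi\<^sub>M J (\<lambda>_. M)) (\<lambda>\<omega>. restrict \<omega> J) = Pi\<^sub>M J (\<lambda>_. M)"
    if "finite J" for J :: "nat set"
    using P.distr_PiM_restrict_finite[of J] that by simp
  have "(\<integral>\<^sup>+\<omega>. u (restrict \<omega> {..<n}) * f (\<omega> n) \<partial>Pi\<^sub>M UNIV (\<lambda>_. M))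
      = (\<integral>\<^sup>+\<omega>. u (restrict (restrict \<omega> {..<Suc n}) {..<n}) * f (restrict \<omega> {..<Suc n} n) \<partial>Pi\<^sub>M UNIV (\<lambda>_. M))"
    by (simp add: Int_absorb1 lessThan_subset_iff)
  also have "\<dots> = (\<integral>\<^sup>+\<omega>. u (restrict \<omega> {..<n}) * f (\<omega> n)
      \<partial>distr (Pi\<^sub>M UNIV (\<lambda>_. M)) (Pi\<^sub>M {..<Suc n} (\<lambda>_. M)) (\<lambda>\<omega>. restrict \<omega> {..<Suc n}))"
    by (subst nn_integral_distr) (auto intro!: measurable_restrict_subset borel_measurable_times_ennreal
      measurable_compose[OF measurable_restrict_subset[of "{..<n}" "{..<Suc n}"] u] measurable_compose[OF _ f])
  also have "\<dots> = (\<integral>\<^sup>+\<omega>. u (restrict \<omega> {..<n}) * f (\<omega> n) \<partial>Pi\<^sub>M (insert n {..<n}) (\<lambda>_. M))"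
    by (subst R) (auto simp: lessThan_Suc)
  also have "\<dots> = (\<integral>\<^sup>+x. \<integral>\<^sup>+y. u (restrict (x(n := y)) {..<n}) * f ((x(n := y)) n) \<partial>M \<partial>Pi\<^sub>M {..<n} (\<lambda>_. M))"
    by (rule P.product_nn_integral_insert)
      (auto intro!: borel_measurable_times_ennreal
      measurable_compose[OF measurable_restrict_subset[of "{..<n}" "insert n {..<n}"] u] measurable_compose[OF _ f])
  also have "\<dots> = (\<integral>\<^sup>+x. u x * (\<integral>\<^sup>+y. f y \<partial>M) \<partial>Pi\<^sub>M {..<n} (\<lambda>_. M))"
  proof (rule nn_integral_cong)
    fix x assume "x \<in> space (Pi\<^sub>M {..<n} (\<lambda>_. M))"
    then have "restrict (x(n := y)) {..<n} = x" for y
      by (auto simp: fun_eq_iff space_PiM PiE_def extensional_def)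
    then show "(\<integral>\<^sup>+y. u (restrict (x(n := y)) {..<n}) * f ((x(n := y)) n) \<partial>M) = u x * (\<integral>\<^sup>+y. f y \<partial>M)"
      by (simp add: nn_integral_cmult)
  qed
  also have "\<dots> = (\<integral>\<^sup>+x. u x \<partial>Pi\<^sub>M {..<n} (\<lambda>_. M)) * (\<integral>\<^sup>+y. f y \<partial>M)"
    by (simp add: nn_integral_multc)
  also have "(\<integral>\<^sup>+x. u x \<partial>Pi\<^sub>M {..<n} (\<lambda>_. M)) = (\<integral>\<^sup>+x. u x
      \<partial>distr (Pi\<^sub>M UNIV (\<lambda>_. M)) (Pi\<^sub>M {..<n} (\<lambda>_. M)) (\<lambda>\<omega>. restrict \<omega> {..<n}))"
    by (subst R) auto
  also have "\<dots> = (\<integral>\<^sup>+\<omega>. u (restrict \<omega> {..<n}) \<partial>Pi\<^sub>M UNIV (\<lambda>_. M))"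
    by (subst nn_integral_distr) (auto intro!: measurable_restrict_subset)
  finally show ?thesis .
qed

lemma nn_integral_PiM_prod_Suc:
  assumes u: "u \<in> borel_measurable (Pi\<^sub>M {..<n} (\<lambda>_. M))"
    and f: "f \<in> borel_measurable M" and "n \<le> (N::nat)"
  shows "(\<integral>\<^sup>+\<omega>. u (restrict \<omega> {..<n}) * (\<Prod>i<Suc N. f (\<omega> i)) \<partial>Pi\<^sub>M UNIV (\<lambda>_. M))
    = (\<integral>\<^sup>+\<omega>. u (restrict \<omega> {..<n}) * (\<Prod>i<N. f (\<omega> i)) \<partial>Pi\<^sub>M UNIV (\<lambda>_. M)) * (\<integral>\<^sup>+x. f x \<partial>M)"
proof -
  let ?u = "\<lambda>x. u (restrict x {..<n}) * (\<Prod>i<N. f (x i))"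
  have "?u \<in> borel_measurable (Pi\<^sub>M {..<N} (\<lambda>_. M))"
    using \<open>n \<le> N\<close> by (auto intro!: borel_measurable_times_ennreal borel_measurable_prod_ennreal
      measurable_compose[OF measurable_restrict_subset[of "{..<n}" "{..<N}"] u] measurable_compose[OF _ f])
  from nn_integral_PiM_restrict_step[OF this f] show ?thesis
    using \<open>n \<le> N\<close> by (simp add: Int_absorb1 Int_absorb2 lessThan_subset_iff mult.assoc)
qed

text \<open>The submartingale property in integrated form: \<open>u\<close> is a function of the
  past up to \<open>n\<close>, and each factor beyond \<open>n\<close> contributes its mean, which
  is at least 1.\<close>

lemma nn_integral_PiM_prod_mono:
  assumes u: "u \<in> borel_measurable (Pi\<^sub>M {..<n} (\<lambda>_. M))"
    and f: "f \<in> borel_measurable M" "1 \<le> (\<integral>\<^sup>+x. f x \<partial>M)" and "n \<le> (N::nat)"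
  shows "(\<integral>\<^sup>+\<omega>. u (restrict \<omega> {..<n}) * (\<Prod>i<n. f (\<omega> i)) \<partial>Pi\<^sub>M UNIV (\<lambda>_. M))
    \<le> (\<integral>\<^sup>+\<omega>. u (restrict \<omega> {..<n}) * (\<Prod>i<N. f (\<omega> i)) \<partial>Pi\<^sub>M UNIV (\<lambda>_. M))"
  using \<open>n \<le> N\<close>
proof (induction N rule: dec_induct)
  case (step N)
  have "(\<integral>\<^sup>+\<omega>. u (restrict \<omega> {..<n}) * (\<Prod>i<N. f (\<omega> i)) \<partial>Pi\<^sub>M UNIV (\<lambda>_. M)) * 1
    \<le> (\<integral>\<^sup>+\<omega>. u (restrict \<omega> {..<n}) * (\<Prod>i<Suc N. f (\<omega> i)) \<partial>Pi\<^sub>M UNIV (\<lambda>_. M))"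
    unfolding nn_integral_PiM_prod_Suc[OF u f(1) step(1)] by (intro mult_left_mono f) auto
  with step.IH show ?case unfolding mult_1_right by (rule order_trans)
qed simp

lemma nn_integral_PiM_prod_power:
  assumes f: "f \<in> borel_measurable M"
  shows "(\<integral>\<^sup>+\<omega>. (\<Prod>i<N. f (\<omega> (i::nat))) \<partial>Pi\<^sub>M UNIV (\<lambda>_. M)) = (\<integral>\<^sup>+x. f x \<partial>M) ^ N"
proof (induction N)
  case 0
  interpret P: prob_space "Pi\<^sub>M (UNIV::nat set) (\<lambda>_. M)" by (intro prob_space_PiM prob_space_axioms)
  show ?case by (simp add: P.emeasure_space_1)
next
  case (Suc N)
  then show ?case
    using nn_integral_PiM_prod_Suc[OF _ f, of "\<lambda>_. 1" 0 N] by (simp add: mult.commute)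
qed

text \<open>The lower bound is Jensen's inequality through \<open>1 + t \<le> exp t\<close>; the
  upper one is Hoeffding's lemma for an interval of length 1, applied to \<open>- f\<close> when
  \<open>l\<close> is negative.\<close>

lemma nn_integral_exp_centered:
  fixes l :: real
  assumes f: "f \<in> borel_measurable M" "\<And>x. x \<in> space M \<Longrightarrow> f x \<in> {0..1::real}"
  shows "1 \<le> (\<integral>\<^sup>+x. ennreal (exp (l * (f x - expectation f))) \<partial>M)"
    and "(\<integral>\<^sup>+x. ennreal (exp (l * (f x - expectation f))) \<partial>M) \<le> ennreal (exp (l\<^sup>2 / 8))"
proof -
  let ?\<phi> = "\<lambda>x. exp (l * (f x - expectation f))"
  have i: "integrable M f"
    using f by (intro integrable_const_bound[where B = 1]) auto
  have "1 = ennreal (expectation (\<lambda>x. 1 + l * (f x - expectation f)))"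
    using i by (simp add: prob_space)
  also have "\<dots> \<le> (\<integral>\<^sup>+x. ennreal (1 + l * (f x - expectation f)) \<partial>M)"
    using i by (intro ennreal_integral_le_nn_integral) auto
  also have "\<dots> \<le> (\<integral>\<^sup>+x. ennreal (?\<phi> x) \<partial>M)"
    by (intro nn_integral_mono ennreal_leI exp_ge_add_one_self)
  finally show "1 \<le> (\<integral>\<^sup>+x. ennreal (?\<phi> x) \<partial>M)" .
  consider "l > 0" | "l = 0" | "l < 0" by linarith
  then show "(\<integral>\<^sup>+x. ennreal (?\<phi> x) \<partial>M) \<le> ennreal (exp (l\<^sup>2 / 8))"
  proof cases
    case 1
    interpret interval_bounded_random_variable M f 0 1
      using f by unfold_locales auto
    show ?thesis using Hoeffdings_lemma_nn_integral[OF 1] by simp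
  next
    case 2
    then show ?thesis by (simp add: emeasure_space_1)
  next
    case 3
    interpret interval_bounded_random_variable M "\<lambda>x. - f x" "-1" 0
      using f by unfold_locales auto
    show ?thesis using Hoeffdings_lemma_nn_integral[of "-l"] 3 by (simp add: algebra_simps)
  qed
qed

lemma nn_integral_PiM_exp_centered_le:
  fixes l :: real
  assumes f: "f \<in> borel_measurable M" "\<And>x. x \<in> space M \<Longrightarrow> f x \<in> {0..1::real}"
  shows "(\<integral>\<^sup>+\<omega>. (\<Prod>i<N. ennreal (exp (l * (f (\<omega> (i::nat)) - expectation f)))) \<partial>Pi\<^sub>M UNIV (\<lambda>_. M))
    \<le> ennreal (exp (l\<^sup>2 * N / 8))"
proof -
  define c where "c = expectation f"
  note [measurable] = f(1)
  have "(\<integral>\<^sup>+\<omega>. (\<Prod>i<N. ennreal (exp (l * (f (\<omega> (i::nat)) - c)))) \<partial>Pi\<^sub>M UNIV (\<lambda>_. M))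
    = (\<integral>\<^sup>+x. ennreal (exp (l * (f x - c))) \<partial>M) ^ N"
    by (rule nn_integral_PiM_prod_power) measurable
  also have "\<dots> \<le> ennreal (exp (l\<^sup>2 / 8)) ^ N"
    unfolding c_def by (intro power_mono nn_integral_exp_centered f) auto
  also have "\<dots> = ennreal (exp (l\<^sup>2 * N / 8))"
    by (simp add: ennreal_power exp_of_nat_mult[symmetric] field_simps)
  finally show ?thesis unfolding c_def .
qed

text \<open>Allowing \<open>l\<^sup>2 / 4\<close> per summand, twice the Hoeffding rate, leaves a
  factor \<open>exp (- l\<^sup>2 / 8) ^ n\<close> in the expectation. The sum over \<open>n\<close>
  is then almost surely finite, its terms tend to 0, and a term below 1 means a negative
  exponent.\<close>

lemma AE_PiM_eventually_sum_centered_le: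
  fixes l :: real
  assumes f: "f \<in> borel_measurable M" "\<And>x. x \<in> space M \<Longrightarrow> f x \<in> {0..1::real}"
    and "l \<noteq> 0"
  shows "AE \<omega> in Pi\<^sub>M UNIV (\<lambda>_::nat. M).
    eventually (\<lambda>n. l * (\<Sum>i<n. f (\<omega> i) - expectation f) \<le> l\<^sup>2 * n / 4) sequentially"
proof -
  define c where "c = expectation f"
  let ?P = "Pi\<^sub>M UNIV (\<lambda>_::nat. M)"
  let ?Z = "\<lambda>n \<omega>. \<Prod>i<n. ennreal (exp (l * (f (\<omega> i) - c)))"
  note [measurable] = f(1)
  have "(\<integral>\<^sup>+\<omega>. (\<Sum>n. ?Z n \<omega> * ennreal (exp (- (l\<^sup>2 * n / 4)))) \<partial>?P)
    = (\<Sum>n. (\<integral>\<^sup>+\<omega>. ?Z n \<omega> \<partial>?P) * ennreal (exp (- (l\<^sup>2 * n / 4))))"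
    by (subst nn_integral_suminf) (auto simp: nn_integral_multc)
  also have "\<dots> \<le> (\<Sum>n. ennreal (exp (l\<^sup>2 * n / 8)) * ennreal (exp (- (l\<^sup>2 * n / 4))))"
    unfolding c_def
    by (intro suminf_le mult_right_mono nn_integral_PiM_exp_centered_le f summableI) auto
  also have "\<dots> = (\<Sum>n. ennreal (exp (- l\<^sup>2 / 8) ^ n))"
    by (simp add: ennreal_mult'[symmetric] exp_add[symmetric] exp_of_nat_mult[symmetric] field_simps)
  also have "\<dots> < \<infinity>"
    using \<open>l \<noteq> 0\<close> by (intro ennreal_suminf_neq_top[THEN top.not_eq_extremum[THEN iffD1], folded infinity_ennreal_def] summable_geometric) auto
  finally have "AE \<omega> in ?P. (\<Sum>n. ?Z n \<omega> * ennreal (exp (- (l\<^sup>2 * n / 4)))) \<noteq> \<infinity>"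
    by (intro nn_integral_noteq_infinite) auto
  then show ?thesis
  proof eventually_elim
    case (elim \<omega>)
    let ?t = "\<lambda>n. exp (l * (\<Sum>i<n. f (\<omega> i) - c) - l\<^sup>2 * n / 4)"
    have "?Z n \<omega> * ennreal (exp (- (l\<^sup>2 * n / 4))) = ennreal (?t n)" for n
      by (simp add: prod_ennreal ennreal_mult'[symmetric] exp_sum[symmetric] exp_add[symmetric] sum_distrib_left)
    with elim have "(\<Sum>n. ennreal (?t n)) \<noteq> top" by simp
    then have "summable ?t" by (intro summable_suminf_not_top) auto
    then have "?t \<longlonglongrightarrow> 0" by (rule summable_LIMSEQ_zero)
    then have "eventually (\<lambda>n. ?t n < 1) sequentially" by (rule order_tendstoD) simp
    then show ?case unfolding c_def[symmetric] by eventually_elim simp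
  qed
qed

text \<open>The rate in Hoeffding's lemma makes the expectations of the exponentials summable, so no fourth
  moment or truncation is needed for bounded summands.\<close>

lemma AE_PiM_average_tendsto:
  assumes f: "f \<in> borel_measurable M" "\<And>x. x \<in> space M \<Longrightarrow> f x \<in> {0..1::real}"
  shows "AE \<omega> in Pi\<^sub>M UNIV (\<lambda>_::nat. M). (\<lambda>n. (\<Sum>i<n. f (\<omega> i)) / n) \<longlonglongrightarrow> expectation f"
proof -
  \<comment> \<open>Countably many slopes \<open>1 / (j + 1)\<close> and their negatives bound the
    average error by \<open>1 / (4 (j + 1))\<close> from both sides.\<close>
  have "AE \<omega> in Pi\<^sub>M UNIV (\<lambda>_::nat. M). \<forall>j::nat. \<forall>s\<in>{1, - 1::real}. eventually (\<lambda>n.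
      s / Suc j * (\<Sum>i<n. f (\<omega> i) - expectation f) \<le> (s / Suc j)\<^sup>2 * n / 4) sequentially"
    unfolding AE_all_countable
    by (intro allI AE_finite_allI AE_PiM_eventually_sum_centered_le f) (auto simp del: of_nat_Suc)
  then show ?thesis
  proof eventually_elim
    case (elim \<omega>)
    show ?case
    proof (rule LIMSEQ_I)
      fix r :: real assume "r > 0"
      then obtain j where j: "1 / Suc j < r" using nat_approx_posE by blast
      have "eventually (\<lambda>n. norm ((\<Sum>i<n. f (\<omega> i)) / n - expectation f) < r) sequentially"
        using elim[THEN spec, of j, THEN bspec, OF insertI1]
          elim[THEN spec, of j, THEN bspec, OF insertI2[OF insertI1]] eventually_gt_at_top[of 0]
      proof eventually_elim
        case (elim n)
        define Y where "Y = (\<Sum>i<n. f (\<omega> i) - expectation f)"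
        define t where "t = 1 / real (Suc j)"
        have "t > 0" by (simp add: t_def)
        have "t * Y \<le> t * (t * n / 4)" "t * (- Y) \<le> t * (t * n / 4)"
        proof -
          have eq: "1 / real (Suc j) = t" "- 1 / real (Suc j) = - t" by (simp_all add: t_def)
          show "t * Y \<le> t * (t * n / 4)" "t * (- Y) \<le> t * (t * n / 4)"
            using elim(1,2) unfolding Y_def[symmetric] eq by (simp_all add: power2_eq_square mult.assoc)
        qed
        then have "\<bar>Y\<bar> \<le> t * n / 4"
          unfolding mult_le_cancel_left_pos[OF \<open>t > 0\<close>] by linarith
        then have "\<bar>Y / n\<bar> \<le> t / 4"
          using elim(3) by (simp add: abs_divide field_simps)
        also have "\<dots> \<le> t" using \<open>t > 0\<close> by simp
        also have "Y / n = (\<Sum>i<n. f (\<omega> i)) / n - expectation f"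
          using elim(3) by (simp add: Y_def sum_subtractf field_simps)
        finally show ?case using j by (simp add: t_def)
      qed
      then show "\<exists>no. \<forall>n\<ge>no. norm ((\<Sum>i<n. f (\<omega> i)) / n - expectation f) < r"
        by (simp add: eventually_sequentially)
    qed
  qed
qed

end

section \<open>Disintegration along a posterior\<close>

text \<open>The defining identity concerns pairs of sets. Measurable induction extends it in
  \<open>u\<close> for a fixed set \<open>B\<close>, and then in \<open>v\<close>; inside an
  expectation, a function of \<open>V\<close> may thus be exchanged for its integral against
  \<open>\<kappa>\<close>.\<close>

lemma regular_conditional_distribution_nn_integral:
  assumes \<kappa>: "regular_conditional_distribution M L U N V \<kappa>"
    and U: "U \<in> M \<rightarrow>\<^sub>M L" and V: "V \<in> M \<rightarrow>\<^sub>M N"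
    and u: "u \<in> borel_measurable L" and v: "v \<in> borel_measurable N"
  shows "(\<integral>\<^sup>+\<omega>. u (U \<omega>) * v (V \<omega>) \<partial>M) = (\<integral>\<^sup>+\<omega>. u (U \<omega>) * (\<integral>\<^sup>+y. v y \<partial>\<kappa> (U \<omega>)) \<partial>M)"
proof -
  have k: "\<kappa> \<in> L \<rightarrow>\<^sub>M subprob_algebra N"
    using \<kappa> by (auto simp: regular_conditional_distribution_def intro: measurable_prob_algebraD)
  note [measurable] = U V u k
  have sets_k: "sets (\<kappa> (U \<omega>)) = sets N" if "\<omega> \<in> space M" for \<omega>
    using sets_kernel[OF k] measurable_space[OF U that] by auto
  have meas_k: "h \<in> borel_measurable (\<kappa> (U \<omega>))" if "h \<in> borel_measurable N" "\<omega> \<in> space M" for h :: "_ \<Rightarrow> ennreal" and \<omega>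
    using that(1) measurable_cong_sets[OF sets_k[OF that(2)] refl] by auto
  have B: "(\<integral>\<^sup>+\<omega>. u (U \<omega>) * indicator B (V \<omega>) \<partial>M) = (\<integral>\<^sup>+\<omega>. u (U \<omega>) * emeasure (\<kappa> (U \<omega>)) B \<partial>M)"
    if B[measurable]: "B \<in> sets N" for B
    using u
  proof (induction rule: borel_measurable_induct)
    case (cong f g)
    then show ?case
      using measurable_space[OF U] by (auto cong: nn_integral_cong)
  next
    case (set A)
    note [measurable] = set
    have "(\<integral>\<^sup>+\<omega>. indicator A (U \<omega>) * indicator B (V \<omega>) \<partial>M)
        = (\<integral>\<^sup>+\<omega>. indicator (U -` A \<inter> V -` B \<inter> space M) \<omega> \<partial>M)"
      by (intro nn_integral_cong) (auto simp: indicator_def)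
    also have "\<dots> = emeasure M (U -` A \<inter> V -` B \<inter> space M)"
    proof (rule nn_integral_indicator)
      have "U -` A \<inter> V -` B \<inter> space M = (U -` A \<inter> space M) \<inter> (V -` B \<inter> space M)" by auto
      also have "\<dots> \<in> sets M" using U V set B by (intro sets.Int measurable_sets)
      finally show "U -` A \<inter> V -` B \<inter> space M \<in> sets M" .
    qed
    also have "\<dots> = (\<integral>\<^sup>+\<omega>\<in>U -` A \<inter> space M. emeasure (\<kappa> (U \<omega>)) B \<partial>M)"
      using \<kappa> set B unfolding regular_conditional_distribution_def by blast
    also have "\<dots> = (\<integral>\<^sup>+\<omega>. indicator A (U \<omega>) * emeasure (\<kappa> (U \<omega>)) B \<partial>M)"
      by (intro nn_integral_cong) (auto simp: indicator_def)
    finally show ?case .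
  next
    case (mult f c)
    note [measurable] = mult.hyps(2)
    from mult show ?case
      by (simp add: nn_integral_cmult mult.assoc measurable_emeasure_kernel)
  next
    case (add f g)
    note [measurable] = add.hyps(1,3)
    from add show ?case
      by (simp add: distrib_right nn_integral_add)
  next
    case (seq F)
    note [measurable] = seq.hyps(1)
    have SUP: "(\<integral>\<^sup>+\<omega>. (\<Squnion>i. F i) (U \<omega>) * h \<omega> \<partial>M) = (\<Squnion>i. \<integral>\<^sup>+\<omega>. F i (U \<omega>) * h \<omega> \<partial>M)"
      if [measurable]: "h \<in> borel_measurable M" for h
    proof -
      have "incseq (\<lambda>i \<omega>. F i (U \<omega>) * h \<omega>)"
        using seq.hyps(3) by (auto simp: incseq_def le_fun_def intro!: mult_right_mono)
      then have "(\<Squnion>i. \<integral>\<^sup>+\<omega>. F i (U \<omega>) * h \<omega> \<partial>M) = (\<integral>\<^sup>+\<omega>. (\<Squnion>i. F i (U \<omega>) * h \<omega>) \<partial>M)"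
        by (intro nn_integral_monotone_convergence_SUP[symmetric]) measurable
      also have "\<dots> = (\<integral>\<^sup>+\<omega>. (\<Squnion>i. F i) (U \<omega>) * h \<omega> \<partial>M)"
        by (intro nn_integral_cong) (simp add: SUP_apply SUP_mult_right_ennreal image_comp)
      finally show ?thesis by simp
    qed
    have m: "(\<lambda>\<omega>. indicator B (V \<omega>) :: ennreal) \<in> borel_measurable M"
      "(\<lambda>\<omega>. emeasure (\<kappa> (U \<omega>)) B) \<in> borel_measurable M"
      by (auto intro!: measurable_compose[OF measurable_compose[OF U k] measurable_emeasure_subprob_algebra] B)
    show ?case
      unfolding SUP[OF m(1)] SUP[OF m(2)] seq.IH ..
  qed
  from v show ?thesis
  proof (induction rule: borel_measurable_induct)
    case (cong f g)
    have "(\<integral>\<^sup>+y. f y \<partial>\<kappa> (U \<omega>)) = (\<integral>\<^sup>+y. g y \<partial>\<kappa> (U \<omega>))" if "\<omega> \<in> space M" for \<omega>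
      using cong(3) sets_eq_imp_space_eq[OF sets_k[OF that]] by (intro nn_integral_cong) auto
    then show ?case
      using cong measurable_space[OF V] by (auto cong: nn_integral_cong)
  next
    case (set B)
    have "(\<integral>\<^sup>+y. indicator B y \<partial>\<kappa> (U \<omega>)) = emeasure (\<kappa> (U \<omega>)) B" if "\<omega> \<in> space M" for \<omega>
      using set sets_k[OF that] by simp
    then show ?case
      using B[OF set] by (auto cong: nn_integral_cong)
  next
    case (mult f c)
    note [measurable] = mult.hyps(2)
    have "(\<integral>\<^sup>+\<omega>. u (U \<omega>) * (\<integral>\<^sup>+y. c * f y \<partial>\<kappa> (U \<omega>)) \<partial>M)
        = (\<integral>\<^sup>+\<omega>. c * (u (U \<omega>) * (\<integral>\<^sup>+y. f y \<partial>\<kappa> (U \<omega>))) \<partial>M)"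
    proof (rule nn_integral_cong)
      fix \<omega> assume \<omega>: "\<omega> \<in> space M"
      show "u (U \<omega>) * (\<integral>\<^sup>+y. c * f y \<partial>\<kappa> (U \<omega>)) = c * (u (U \<omega>) * (\<integral>\<^sup>+y. f y \<partial>\<kappa> (U \<omega>)))"
        using meas_k[OF mult.hyps(2) \<omega>] by (simp add: nn_integral_cmult mult_ac)
    qed
    also have "\<dots> = c * (\<integral>\<^sup>+\<omega>. u (U \<omega>) * (\<integral>\<^sup>+y. f y \<partial>\<kappa> (U \<omega>)) \<partial>M)"
      by (intro nn_integral_cmult borel_measurable_times_ennreal measurable_compose[OF U u]
          measurable_compose[OF measurable_compose[OF U k] nn_integral_measurable_subprob_algebra] mult.hyps(2))
    also have "(\<integral>\<^sup>+\<omega>. u (U \<omega>) * (\<integral>\<^sup>+y. f y \<partial>\<kappa> (U \<omega>)) \<partial>M) = (\<integral>\<^sup>+\<omega>. u (U \<omega>) * f (V \<omega>) \<partial>M)"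
      using mult by simp
    also have "c * \<dots> = (\<integral>\<^sup>+\<omega>. c * (u (U \<omega>) * f (V \<omega>)) \<partial>M)"
      by (simp add: nn_integral_cmult)
    finally show ?case by (simp add: mult_ac)
  next
    case (add f g)
    note [measurable] = add.hyps(1,3)
    have m: "(\<lambda>\<omega>. u (U \<omega>) * (\<integral>\<^sup>+y. h y \<partial>\<kappa> (U \<omega>))) \<in> borel_measurable M" if "h \<in> borel_measurable N" for h
      by (intro borel_measurable_times_ennreal measurable_compose[OF U u]
          measurable_compose[OF measurable_compose[OF U k] nn_integral_measurable_subprob_algebra] that)
    have "(\<integral>\<^sup>+\<omega>. u (U \<omega>) * (\<integral>\<^sup>+y. g y + f y \<partial>\<kappa> (U \<omega>)) \<partial>M)
        = (\<integral>\<^sup>+\<omega>. u (U \<omega>) * (\<integral>\<^sup>+y. g y \<partial>\<kappa> (U \<omega>)) + u (U \<omega>) * (\<integral>\<^sup>+y. f y \<partial>\<kappa> (U \<omega>)) \<partial>M)"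
    proof (rule nn_integral_cong)
      fix \<omega> assume \<omega>: "\<omega> \<in> space M"
      show "u (U \<omega>) * (\<integral>\<^sup>+y. g y + f y \<partial>\<kappa> (U \<omega>))
        = u (U \<omega>) * (\<integral>\<^sup>+y. g y \<partial>\<kappa> (U \<omega>)) + u (U \<omega>) * (\<integral>\<^sup>+y. f y \<partial>\<kappa> (U \<omega>))"
        using meas_k[OF add.hyps(1) \<omega>] meas_k[OF add.hyps(3) \<omega>] by (simp add: nn_integral_add distrib_left)
    qed
    also have "\<dots> = (\<integral>\<^sup>+\<omega>. u (U \<omega>) * g (V \<omega>) \<partial>M) + (\<integral>\<^sup>+\<omega>. u (U \<omega>) * f (V \<omega>) \<partial>M)"
      using add by (simp add: nn_integral_add m)
    also have "\<dots> = (\<integral>\<^sup>+\<omega>. u (U \<omega>) * (g (V \<omega>) + f (V \<omega>)) \<partial>M)"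
      by (simp add: nn_integral_add distrib_left)
    finally show ?case by simp
  next
    case (seq F)
    note [measurable] = seq.hyps(1)
    have m: "(\<lambda>\<omega>. u (U \<omega>) * (\<integral>\<^sup>+y. F i y \<partial>\<kappa> (U \<omega>))) \<in> borel_measurable M" for i
      by (intro borel_measurable_times_ennreal measurable_compose[OF U u]
          measurable_compose[OF measurable_compose[OF U k] nn_integral_measurable_subprob_algebra] seq.hyps(1))
    have inc: "incseq (\<lambda>i \<omega>. u (U \<omega>) * F i (V \<omega>))" "incseq (\<lambda>i \<omega>. u (U \<omega>) * (\<integral>\<^sup>+y. F i y \<partial>\<kappa> (U \<omega>)))"
      using seq.hyps(3) by (auto simp: incseq_def le_fun_def intro!: mult_left_mono nn_integral_mono)
    have "(\<integral>\<^sup>+\<omega>. u (U \<omega>) * (\<integral>\<^sup>+y. (\<Squnion>i. F i) y \<partial>\<kappa> (U \<omega>)) \<partial>M)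
        = (\<integral>\<^sup>+\<omega>. (\<Squnion>i. u (U \<omega>) * (\<integral>\<^sup>+y. F i y \<partial>\<kappa> (U \<omega>))) \<partial>M)"
    proof (rule nn_integral_cong)
      fix \<omega> assume \<omega>: "\<omega> \<in> space M"
      show "u (U \<omega>) * (\<integral>\<^sup>+y. (\<Squnion>i. F i) y \<partial>\<kappa> (U \<omega>)) = (\<Squnion>i. u (U \<omega>) * (\<integral>\<^sup>+y. F i y \<partial>\<kappa> (U \<omega>)))"
        using seq.hyps(3) meas_k[OF seq.hyps(1) \<omega>]
        by (simp add: SUP_apply image_comp nn_integral_monotone_convergence_SUP SUP_mult_left_ennreal)
    qed
    also have "\<dots> = (\<Squnion>i. \<integral>\<^sup>+\<omega>. u (U \<omega>) * F i (V \<omega>) \<partial>M)"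
      unfolding nn_integral_monotone_convergence_SUP[OF inc(2) m] seq.IH ..
    also have "\<dots> = (\<integral>\<^sup>+\<omega>. u (U \<omega>) * (\<Squnion>i. F i) (V \<omega>) \<partial>M)"
      by (subst nn_integral_monotone_convergence_SUP[OF inc(1), symmetric])
        (auto simp: SUP_apply SUP_mult_left_ennreal image_comp)
    finally show ?case by simp
  qed
qed

text \<open>The probabilistic part is separated from the topology: \<open>N\<close> is any
  measurable space of laws whose identity map into \<open>prob_algebra M\<close> is measurable, and
  the limit property of \<open>ptilde\<close> is imposed only on the integrals of the countably many
  \<open>f k\<close>, later the normalized \<open>g\<^sub>k\<close>.\<close>

locale mixture_posterior =
  fixes M :: "'a measure" and N :: "'a measure measure" and q :: "'a measure measure"
    and \<rho> :: "(nat \<Rightarrow> 'a) measure" and ptilde :: "(nat \<Rightarrow> 'a) \<Rightarrow> 'a measure"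
    and post :: "nat \<Rightarrow> (nat \<Rightarrow> 'a) \<Rightarrow> 'a measure measure" and f :: "nat \<Rightarrow> 'a \<Rightarrow> real"
  assumes id_measurable: "(\<lambda>p. p) \<in> N \<rightarrow>\<^sub>M prob_algebra M"
    and q: "q \<in> space (prob_algebra N)"
    and rho: "\<rho> = q \<bind> (\<lambda>p. Pi\<^sub>M UNIV (\<lambda>_. p))"
    and ptilde: "ptilde \<in> \<rho> \<rightarrow>\<^sub>M N"
    and post: "\<And>n. n \<ge> 1 \<Longrightarrow> regular_conditional_distribution \<rho> (Pi\<^sub>M {..<n} (\<lambda>_. M))
      (\<lambda>\<omega>. restrict \<omega> {..<n}) N ptilde (post n)"
    and f_measurable: "\<And>k. f k \<in> borel_measurable M"
    and f_range: "\<And>k x. x \<in> space M \<Longrightarrow> f k x \<in> {0..1}"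
    and limit: "AE \<omega> in \<rho>. \<forall>k. (\<lambda>n. (\<Sum>i<n. f k (\<omega> i)) / n) \<longlonglongrightarrow> (\<integral>x. f k x \<partial>ptilde \<omega>)"
begin

section \<open>Disintegration of the exchangeable law\<close>

definition mean :: "nat \<Rightarrow> 'a measure \<Rightarrow> real" where "mean k p = (\<integral>x. f k x \<partial>p)"

lemma space_q: "space q = space N" and sets_q: "sets q = sets N"
  and prob_space_q: "prob_space q"
  using q by (auto simp: space_prob_algebra dest: sets_eq_imp_space_eq)

lemma prob_space_law: "p \<in> space N \<Longrightarrow> prob_space p"
  and sets_law: "p \<in> space N \<Longrightarrow> sets p = sets M"
  and space_law: "p \<in> space N \<Longrightarrow> space p = space M"
  using measurable_space[OF id_measurable] by (auto simp: space_prob_algebra dest: sets_eq_imp_space_eq)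

lemma f_measurable_law: "p \<in> space N \<Longrightarrow> f k \<in> borel_measurable p"
  using f_measurable sets_law by (simp cong: measurable_cong_sets)

lemma f_range_law: "p \<in> space N \<Longrightarrow> x \<in> space p \<Longrightarrow> f k x \<in> {0..1}"
  using f_range space_law by simp

lemma mean_measurable [measurable]: "mean k \<in> borel_measurable N"
proof -
  have "(\<lambda>p. integral\<^sup>L p (f k)) \<in> borel_measurable (subprob_algebra M)"
    using f_measurable f_range by (intro integral_measurable_subprob_algebra) auto
  from measurable_compose[OF measurable_prob_algebraD[OF id_measurable] this]
  show ?thesis unfolding mean_def by simp
qed

lemma mean_range: "p \<in> space N \<Longrightarrow> mean k p \<in> {0..1}"
  unfolding mean_def
  by (intro integral_in_unit_interval prob_space_law f_measurable_law f_range_law)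

lemma kernel: "(\<lambda>p. Pi\<^sub>M UNIV (\<lambda>_. p)) \<in> N \<rightarrow>\<^sub>M prob_algebra (Pi\<^sub>M (UNIV::nat set) (\<lambda>_. M))"
  using measurable_compose[OF id_measurable measurable_PiM_power] .

lemma kernel_q: "(\<lambda>p. Pi\<^sub>M UNIV (\<lambda>_. p)) \<in> q \<rightarrow>\<^sub>M subprob_algebra (Pi\<^sub>M (UNIV::nat set) (\<lambda>_. M))"
  using measurable_prob_algebraD[OF kernel] by (simp cong: measurable_cong_sets add: sets_q)

lemma rho_prob_algebra: "\<rho> \<in> space (prob_algebra (Pi\<^sub>M UNIV (\<lambda>_. M)))"
  \<comment> \<open>Composition is stated for kernels, so \<open>q\<close> enters as a constant
    kernel, evaluated at an arbitrary point.\<close>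
  unfolding rho using measurable_bind_prob_space[OF measurable_const, OF q kernel, THEN measurable_space, of undefined "count_space UNIV"]
  by simp

lemma sets_rho: "sets \<rho> = sets (Pi\<^sub>M UNIV (\<lambda>_. M))"
  and prob_space_rho: "prob_space \<rho>"
  using rho_prob_algebra by (auto simp: space_prob_algebra)

lemma restrict_rho: "(\<lambda>\<omega>. restrict \<omega> J) \<in> \<rho> \<rightarrow>\<^sub>M Pi\<^sub>M J (\<lambda>_. M)"
  by (simp cong: measurable_cong_sets add: sets_rho measurable_restrict_subset)

lemma restrict_measurable: "J \<subseteq> K \<Longrightarrow> (\<lambda>\<omega>. restrict \<omega> J) \<in> Pi\<^sub>M K (\<lambda>_. M) \<rightarrow>\<^sub>M Pi\<^sub>M J (\<lambda>_. M)"
  by (rule measurable_restrict_subset)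

lemma f_component_measurable: "i \<in> J \<Longrightarrow> (\<lambda>\<omega>. f k (\<omega> i)) \<in> borel_measurable (Pi\<^sub>M J (\<lambda>_. M))"
  by (rule measurable_compose[OF measurable_component_singleton[of i J "\<lambda>_. M"] f_measurable])

lemma nn_integral_rho:
  assumes "h \<in> borel_measurable (Pi\<^sub>M UNIV (\<lambda>_. M))"
  shows "(\<integral>\<^sup>+\<omega>. h \<omega> \<partial>\<rho>) = (\<integral>\<^sup>+p. \<integral>\<^sup>+\<omega>. h \<omega> \<partial>Pi\<^sub>M UNIV (\<lambda>_. p) \<partial>q)"
  unfolding rho by (rule nn_integral_bind[OF assms kernel_q])

text \<open>Two limits of the same averages: under the mixture they converge to the means of
  \<open>ptilde\<close>, under the powers of \<open>p\<close> to those of \<open>p\<close> by the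
  law of large numbers. Hence \<open>ptilde\<close> may be replaced by the mixing law wherever it
  enters through \<open>mean\<close>.\<close>

lemma AE_mean_ptilde: "AE p in q. AE \<omega> in Pi\<^sub>M UNIV (\<lambda>_. p). \<forall>k. mean k (ptilde \<omega>) = mean k p"
proof -
  interpret q: prob_space q by (rule prob_space_q)
  have "AE p in q. AE \<omega> in Pi\<^sub>M (UNIV::nat set) (\<lambda>_. p).
      \<forall>k. (\<lambda>n. (\<Sum>i<n. f k (\<omega> i)) / n) \<longlonglongrightarrow> (\<integral>x. f k x \<partial>ptilde \<omega>)"
    using limit unfolding rho by (intro AE_bindD[OF kernel_q q.not_empty])
  moreover have "AE p in q. p \<in> space N" using space_q by auto
  ultimately show ?thesis
  proof eventually_elim
    case (elim p)
    interpret p: prob_space p using elim(2) by (rule prob_space_law)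
    have "AE \<omega> in Pi\<^sub>M (UNIV::nat set) (\<lambda>_. p). \<forall>k. (\<lambda>n. (\<Sum>i<n. f k (\<omega> i)) / n) \<longlonglongrightarrow> (\<integral>x. f k x \<partial>p)"
      unfolding AE_all_countable
      by (intro allI p.AE_PiM_average_tendsto f_measurable_law f_range_law[OF elim(2)] elim)
    with elim(1) show ?case
      unfolding mean_def by eventually_elim (blast intro: LIMSEQ_unique)
  qed
qed

text \<open>The conditional expectation given the first \<open>n\<close> observations of the exponential of \<open>l\<close> times
  the centred sum; the posterior mean only enters through its Laplace transform.\<close>

definition expo :: "nat \<Rightarrow> nat \<Rightarrow> real \<Rightarrow> (nat \<Rightarrow> 'a) \<Rightarrow> ennreal" where
  "expo n k l x = (\<Prod>i<n. ennreal (exp (l * f k (x i)))) * (\<integral>\<^sup>+p. ennreal (exp (- (l * n * mean k p))) \<partial>post n x)"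

lemma post_measurable: "n \<ge> 1 \<Longrightarrow> post n \<in> Pi\<^sub>M {..<n} (\<lambda>_. M) \<rightarrow>\<^sub>M prob_algebra N"
  using post by (auto simp: regular_conditional_distribution_def)

lemma expo_measurable:
  assumes "n \<ge> 1" shows "expo n k l \<in> borel_measurable (Pi\<^sub>M {..<n} (\<lambda>_. M))"
proof -
  have "(\<lambda>p. ennreal (exp (- (l * n * mean k p)))) \<in> borel_measurable N" by measurable
  from measurable_compose[OF measurable_prob_algebraD[OF post_measurable[OF assms]]
      nn_integral_measurable_subprob_algebra[OF this]]
  have [measurable]: "(\<lambda>x. \<integral>\<^sup>+p. ennreal (exp (- (l * n * mean k p))) \<partial>post n x) \<in> borel_measurable (Pi\<^sub>M {..<n} (\<lambda>_. M))"
    by simp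
  show ?thesis unfolding expo_def
    by (intro borel_measurable_times_ennreal borel_measurable_prod_ennreal measurable_compose[OF _ measurable_ennreal]
        measurable_compose[OF _ borel_measurable_exp] borel_measurable_times borel_measurable_const f_component_measurable)
      auto
qed

text \<open>The step that removes the posterior. Its Laplace transform turns into the exponential of
  the mean of \<open>ptilde\<close>; after disintegration over \<open>q\<close> this is the mean of
  \<open>p\<close>, and a centred sum of independent terms appears.\<close>

lemma nn_integral_expo:
  assumes "n \<ge> 1" and u: "u \<in> borel_measurable (Pi\<^sub>M {..<n} (\<lambda>_. M))"
  shows "(\<integral>\<^sup>+\<omega>. u (restrict \<omega> {..<n}) * expo n k l (restrict \<omega> {..<n}) \<partial>\<rho>)
    = (\<integral>\<^sup>+p. \<integral>\<^sup>+\<omega>. u (restrict \<omega> {..<n}) * (\<Prod>i<n. ennreal (exp (l * (f k (\<omega> i) - mean k p)))) \<partial>Pi\<^sub>M UNIV (\<lambda>_. p) \<partial>q)"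
proof -
  note [measurable] = u ptilde
  define U where "U x = u x * (\<Prod>i<n. ennreal (exp (l * f k (x i))))" for x
  define V where "V p = ennreal (exp (- (l * n * mean k p)))" for p
  have U: "U \<in> borel_measurable (Pi\<^sub>M {..<n} (\<lambda>_. M))"
    unfolding U_def by (intro borel_measurable_times_ennreal borel_measurable_prod_ennreal u
        measurable_compose[OF measurable_compose[OF borel_measurable_times[OF borel_measurable_const f_component_measurable] borel_measurable_exp] measurable_ennreal])
  have V: "V \<in> borel_measurable N" unfolding V_def by measurable
  have "(\<integral>\<^sup>+\<omega>. u (restrict \<omega> {..<n}) * expo n k l (restrict \<omega> {..<n}) \<partial>\<rho>)
      = (\<integral>\<^sup>+\<omega>. U (restrict \<omega> {..<n}) * (\<integral>\<^sup>+p. V p \<partial>post n (restrict \<omega> {..<n})) \<partial>\<rho>)"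
    by (simp add: expo_def U_def V_def mult.assoc)
  also have "\<dots> = (\<integral>\<^sup>+\<omega>. U (restrict \<omega> {..<n}) * V (ptilde \<omega>) \<partial>\<rho>)"
    using regular_conditional_distribution_nn_integral[OF post[OF assms(1)] restrict_rho ptilde U V] by simp
  also have "\<dots> = (\<integral>\<^sup>+p. \<integral>\<^sup>+\<omega>. U (restrict \<omega> {..<n}) * V (ptilde \<omega>) \<partial>Pi\<^sub>M UNIV (\<lambda>_. p) \<partial>q)"
  proof (rule nn_integral_rho)
    have "(\<lambda>\<omega>. U (restrict \<omega> {..<n}) * V (ptilde \<omega>)) \<in> borel_measurable \<rho>"
      by (rule borel_measurable_times_ennreal[OF measurable_compose[OF restrict_rho U] measurable_compose[OF ptilde V]])
    then show "(\<lambda>\<omega>. U (restrict \<omega> {..<n}) * V (ptilde \<omega>)) \<in> borel_measurable (Pi\<^sub>M UNIV (\<lambda>_. M))"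
      by (simp cong: measurable_cong_sets add: sets_rho)
  qed
  also have "\<dots> = (\<integral>\<^sup>+p. \<integral>\<^sup>+\<omega>. u (restrict \<omega> {..<n}) * (\<Prod>i<n. ennreal (exp (l * (f k (\<omega> i) - mean k p)))) \<partial>Pi\<^sub>M UNIV (\<lambda>_. p) \<partial>q)"
  proof (rule nn_integral_cong_AE)
    show "AE p in q. (\<integral>\<^sup>+\<omega>. U (restrict \<omega> {..<n}) * V (ptilde \<omega>) \<partial>Pi\<^sub>M UNIV (\<lambda>_. p))
      = (\<integral>\<^sup>+\<omega>. u (restrict \<omega> {..<n}) * (\<Prod>i<n. ennreal (exp (l * (f k (\<omega> i) - mean k p)))) \<partial>Pi\<^sub>M UNIV (\<lambda>_. p))"
      using AE_mean_ptilde
    proof eventually_elim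
      case (elim p)
      show ?case
      proof (rule nn_integral_cong_AE)
        show "AE \<omega> in Pi\<^sub>M UNIV (\<lambda>_. p). U (restrict \<omega> {..<n}) * V (ptilde \<omega>)
          = u (restrict \<omega> {..<n}) * (\<Prod>i<n. ennreal (exp (l * (f k (\<omega> i) - mean k p))))"
          using elim
        proof eventually_elim
          case (elim \<omega>)
          have "(\<Sum>i<n. l * f k (\<omega> i)) + - (l * n * mean k p) = (\<Sum>i<n. l * (f k (\<omega> i) - mean k p))"
            by (simp add: right_diff_distrib sum_subtractf)
          then have "(\<Prod>i<n. ennreal (exp (l * f k (\<omega> i)))) * V p = (\<Prod>i<n. ennreal (exp (l * (f k (\<omega> i) - mean k p))))"
            by (simp only: V_def prod_ennreal exp_ge_zero ennreal_mult[symmetric] exp_sum[symmetric] exp_add[symmetric] finite_lessThan)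
          with elim show ?case by (simp add: U_def V_def mult.assoc)
        qed
      qed
    qed
  qed
  finally show ?thesis .
qed

subsection \<open>The maximal inequality\<close>

lemma sets_PiM_law: "p \<in> space N \<Longrightarrow> sets (Pi\<^sub>M J (\<lambda>_. p)) = sets (Pi\<^sub>M J (\<lambda>_. M))"
  by (intro sets_PiM_cong sets_law refl)

lemma borel_measurable_PiM_law:
  "p \<in> space N \<Longrightarrow> u \<in> borel_measurable (Pi\<^sub>M J (\<lambda>_. M)) \<Longrightarrow> u \<in> borel_measurable (Pi\<^sub>M J (\<lambda>_. p))"
  using measurable_cong_sets[OF sets_PiM_law refl] by blast

definition weight :: "nat \<Rightarrow> nat \<Rightarrow> real \<Rightarrow> 'a measure \<Rightarrow> (nat \<Rightarrow> 'a) \<Rightarrow> ennreal" where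
  "weight n k l p \<omega> = (\<Prod>i<n. ennreal (exp (l * (f k (\<omega> i) - mean k p))))"

lemma weight_measurable: "case_prod (weight n k l) \<in> borel_measurable (N \<Otimes>\<^sub>M Pi\<^sub>M UNIV (\<lambda>_. M))"
proof -
  have "(\<lambda>z. l * (f k (snd z i) - mean k (fst z))) \<in> borel_measurable (N \<Otimes>\<^sub>M Pi\<^sub>M UNIV (\<lambda>_. M))" for i
    by (intro borel_measurable_times borel_measurable_diff borel_measurable_const
        measurable_compose[OF measurable_snd f_component_measurable[OF UNIV_I]]
        measurable_compose[OF measurable_fst mean_measurable])
  from measurable_compose[OF this borel_measurable_exp]
  have "(\<lambda>z. exp (l * (f k (snd z i) - mean k (fst z)))) \<in> borel_measurable (N \<Otimes>\<^sub>M Pi\<^sub>M UNIV (\<lambda>_. M))" for i .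
  from measurable_compose[OF this measurable_ennreal] show ?thesis
    unfolding weight_def split_beta' by (intro borel_measurable_prod_ennreal)
qed

lemma weight_measurable_law:
  assumes "p \<in> space N" shows "weight n k l p \<in> borel_measurable (Pi\<^sub>M UNIV (\<lambda>_. p))"
  using measurable_compose[OF measurable_Pair1'[OF assms] weight_measurable]
  by (intro borel_measurable_PiM_law[OF assms]) simp

text \<open>Lets the finite sum over the sample sizes of a block pass through the integral over
  \<open>q\<close>.\<close>

lemma nn_integral_weight_measurable:
  assumes u: "u \<in> borel_measurable (Pi\<^sub>M {..<n} (\<lambda>_. M))"
  shows "(\<lambda>p. \<integral>\<^sup>+\<omega>. u (restrict \<omega> {..<n}) * weight m k l p \<omega> \<partial>Pi\<^sub>M UNIV (\<lambda>_. p)) \<in> borel_measurable q"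
proof -
  have "(\<lambda>p. \<integral>\<^sup>+\<omega>. u (restrict \<omega> {..<n}) * weight m k l p \<omega> \<partial>Pi\<^sub>M UNIV (\<lambda>_. p)) \<in> borel_measurable N"
  proof (rule nn_integral_measurable_subprob_algebra2[OF _ measurable_prob_algebraD[OF kernel]])
    have "(\<lambda>z. u (restrict (snd z) {..<n})) \<in> borel_measurable (N \<Otimes>\<^sub>M Pi\<^sub>M UNIV (\<lambda>_. M))"
      by (rule measurable_compose[OF measurable_snd measurable_compose[OF restrict_measurable[OF subset_UNIV] u]])
    from borel_measurable_times_ennreal[OF this weight_measurable]
    show "(\<lambda>(p, \<omega>). u (restrict \<omega> {..<n}) * weight m k l p \<omega>) \<in> borel_measurable (N \<Otimes>\<^sub>M Pi\<^sub>M UNIV (\<lambda>_. M))"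
      by (simp add: split_beta')
  qed
  then show ?thesis by (simp cong: measurable_cong_sets add: sets_q)
qed

text \<open>The submartingale inequality for the conditional exponentials, tested against a function
  \<open>u\<close> of the first \<open>n\<close> observations. The right side already lives at the
  later time \<open>m\<close>, so all sample sizes of a block can be compared there.\<close>

lemma nn_integral_expo_le:
  assumes "1 \<le> n" "n \<le> m" and u: "u \<in> borel_measurable (Pi\<^sub>M {..<n} (\<lambda>_. M))"
  shows "(\<integral>\<^sup>+\<omega>. u (restrict \<omega> {..<n}) * expo n k l (restrict \<omega> {..<n}) \<partial>\<rho>)
    \<le> (\<integral>\<^sup>+p. \<integral>\<^sup>+\<omega>. u (restrict \<omega> {..<n}) * weight m k l p \<omega> \<partial>Pi\<^sub>M UNIV (\<lambda>_. p) \<partial>q)"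
  unfolding nn_integral_expo[OF assms(1) u] weight_def
proof (rule nn_integral_mono)
  fix p assume "p \<in> space q"
  then have p: "p \<in> space N" by (simp add: space_q)
  interpret p: prob_space p using p by (rule prob_space_law)
  define c where "c = mean k p"
  note [measurable] = f_measurable_law[OF p]
  show "(\<integral>\<^sup>+\<omega>. u (restrict \<omega> {..<n}) * (\<Prod>i<n. ennreal (exp (l * (f k (\<omega> i) - mean k p)))) \<partial>Pi\<^sub>M UNIV (\<lambda>_. p))
    \<le> (\<integral>\<^sup>+\<omega>. u (restrict \<omega> {..<n}) * (\<Prod>i<m. ennreal (exp (l * (f k (\<omega> i) - mean k p)))) \<partial>Pi\<^sub>M UNIV (\<lambda>_. p))"
    unfolding c_def[symmetric]
  proof (rule p.nn_integral_PiM_prod_mono[where f = "\<lambda>x. ennreal (exp (l * (f k x - c)))",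
        OF borel_measurable_PiM_law[OF p u] _ _ assms(2)])
    show "1 \<le> (\<integral>\<^sup>+x. ennreal (exp (l * (f k x - c))) \<partial>p)"
      unfolding c_def mean_def
      by (intro p.nn_integral_exp_centered(1) f_measurable_law[OF p] f_range_law[OF p])
  qed measurable
qed

text \<open>The weights \<open>2\<^sup>-\<^sup>k\<close>, \<open>k \<ge> 1\<close>, are shifted to \<open>k \<ge> 0\<close>.\<close>

definition total :: "nat \<Rightarrow> real \<Rightarrow> (nat \<Rightarrow> 'a) \<Rightarrow> ennreal" where
  "total n l x = (\<Sum>k. ennreal ((1/2) ^ Suc k) * (expo n k l x + expo n k (- l) x))"

lemma total_measurable [measurable]:
  assumes "n \<ge> 1" shows "total n l \<in> borel_measurable (Pi\<^sub>M {..<n} (\<lambda>_. M))"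
proof -
  note [measurable] = expo_measurable[OF assms]
  show ?thesis unfolding total_def by measurable
qed

lemma suminf_half: "(\<Sum>k. ennreal ((1/2) ^ Suc k)) = 1"
  unfolding ennreal_1[symmetric] by (rule suminf_ennreal_eq[OF _ power_half_series]) simp

text \<open>Doob's maximal inequality, by decomposing over the first exceedance.\<close>

lemma total_maximal:
  assumes "1 \<le> a"
  shows "\<Lambda> * emeasure \<rho> {\<omega> \<in> space \<rho>. \<exists>n\<in>{a..b}. \<Lambda> \<le> total n l (restrict \<omega> {..<n})}
    \<le> 2 * ennreal (exp (l\<^sup>2 * b / 8))"
proof -
  \<comment> \<open>Here \<open>n\<close> is the first sample size from \<open>a\<close> on that
    reaches the level. The event is a set of \<open>n\<close>-tuples, so its indicator
    \<open>u n\<close> is an admissible test function of the past.\<close>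
  define B where "B n = {x \<in> space (Pi\<^sub>M {..<n} (\<lambda>_. M)). \<Lambda> \<le> total n l x \<and>
    (\<forall>m\<in>{a..<n}. \<not> \<Lambda> \<le> total m l (restrict x {..<m}))}" for n
  define u where "u n = (indicator (B n) :: _ \<Rightarrow> ennreal)" for n
  define E where "E = {\<omega> \<in> space \<rho>. \<exists>n\<in>{a..b}. \<Lambda> \<le> total n l (restrict \<omega> {..<n})}"
  \<comment> \<open>All first-exceedance events are charged at the common final time
    \<open>b\<close>.\<close>
  define I where "I n k l = (\<integral>\<^sup>+p. \<integral>\<^sup>+\<omega>. u n (restrict \<omega> {..<n}) * weight b k l p \<omega> \<partial>Pi\<^sub>M UNIV (\<lambda>_. p) \<partial>q)" for n k l
  have tot_restrict: "(\<lambda>x. total m l (restrict x {..<m})) \<in> borel_measurable (Pi\<^sub>M {..<n} (\<lambda>_. M))" if "m \<in> {a..<n}" for m n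
    using that \<open>1 \<le> a\<close> by (intro measurable_compose[OF restrict_measurable total_measurable]) auto
  have u: "u n \<in> borel_measurable (Pi\<^sub>M {..<n} (\<lambda>_. M))" if "n \<in> {a..b}" for n
  proof -
    note [measurable] = tot_restrict
    have [measurable]: "total n l \<in> borel_measurable (Pi\<^sub>M {..<n} (\<lambda>_. M))"
      using that \<open>1 \<le> a\<close> by (intro total_measurable) auto
    have "B n \<in> sets (Pi\<^sub>M {..<n} (\<lambda>_. M))"
      unfolding B_def by measurable
    then show ?thesis unfolding u_def by simp
  qed
  have tot_rho: "(\<lambda>\<omega>. total n l (restrict \<omega> {..<n})) \<in> borel_measurable \<rho>" if "n \<in> {a..b}" for n
    using that \<open>1 \<le> a\<close> by (intro measurable_compose[OF restrict_rho total_measurable]) auto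
  have E: "E \<in> sets \<rho>"
  proof -
    note [measurable] = tot_rho
    show ?thesis unfolding E_def by measurable
  qed
  have rs: "restrict \<omega> {..<n} \<in> space (Pi\<^sub>M {..<n} (\<lambda>_. M))" if "\<omega> \<in> space \<rho>" for \<omega> n
    using measurable_space[OF restrict_rho that] .
  have rr: "restrict (restrict \<omega> {..<n}) {..<m} = restrict \<omega> {..<m}" if "m \<le> n" for \<omega> :: "nat \<Rightarrow> 'a" and m n
    using that by (auto simp: restrict_def)
  have first: "\<Lambda> * indicator E \<omega> \<le> (\<Sum>n\<in>{a..b}. u n (restrict \<omega> {..<n}) * total n l (restrict \<omega> {..<n}))" (is "_ \<le> sum ?g _")
    if \<omega>: "\<omega> \<in> space \<rho>" for \<omega>
  proof (cases "\<omega> \<in> E")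
    case True
    then obtain n0 where n0: "n0 \<in> {a..b} \<and> \<Lambda> \<le> total n0 l (restrict \<omega> {..<n0})" unfolding E_def by auto
    define n where "n = (LEAST n. n \<in> {a..b} \<and> \<Lambda> \<le> total n l (restrict \<omega> {..<n}))"
    have n: "n \<in> {a..b}" "\<Lambda> \<le> total n l (restrict \<omega> {..<n})"
      using LeastI[where P = "\<lambda>n. n \<in> {a..b} \<and> \<Lambda> \<le> total n l (restrict \<omega> {..<n})", OF n0] unfolding n_def by auto
    have "\<not> \<Lambda> \<le> total m l (restrict \<omega> {..<m})" if "m \<in> {a..<n}" for m
      using not_less_Least[where P = "\<lambda>n. n \<in> {a..b} \<and> \<Lambda> \<le> total n l (restrict \<omega> {..<n})" and k = m] that n(1)
      unfolding n_def[symmetric] by auto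
    then have "restrict \<omega> {..<n} \<in> B n"
      unfolding B_def using n rs[OF \<omega>] by (auto simp: rr simp del: restrict_restrict)
    then have "\<Lambda> * indicator E \<omega> \<le> ?g n" using n True by (simp add: u_def)
    also have "\<dots> \<le> sum ?g {a..b}" using n by (intro member_le_sum) auto
    finally show ?thesis .
  qed simp
  have u_sum: "(\<Sum>n\<in>{a..b}. u n (restrict \<omega> {..<n})) \<le> 1" for \<omega>
  proof (cases "\<exists>n\<in>{a..b}. restrict \<omega> {..<n} \<in> B n")
    case True
    then obtain n where n: "n \<in> {a..b}" "restrict \<omega> {..<n} \<in> B n" by auto
    have "restrict \<omega> {..<m} \<notin> B m" if m: "m \<in> {a..b}" "m \<noteq> n" for m
    proof
      assume "restrict \<omega> {..<m} \<in> B m"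
      with n m show False
        unfolding B_def by (cases "m < n") (auto simp: rr simp del: restrict_restrict)
    qed
    then have "(\<Sum>n\<in>{a..b}. u n (restrict \<omega> {..<n})) = (\<Sum>m\<in>{n}. u m (restrict \<omega> {..<m}))"
      using n by (intro sum.mono_neutral_right) (auto simp: u_def)
    then show ?thesis using n by (simp add: u_def)
  qed (simp add: u_def)
  \<comment> \<open>Since at most one \<open>u n\<close> is 1, the whole sum costs a single
    exponential moment at time \<open>b\<close>.\<close>
  have I_sum: "(\<Sum>n\<in>{a..b}. I n k l) \<le> ennreal (exp (l\<^sup>2 * b / 8))" for k l
  proof -
    interpret q: prob_space q by (rule prob_space_q)
    have "(\<Sum>n\<in>{a..b}. I n k l)
      = (\<integral>\<^sup>+p. (\<Sum>n\<in>{a..b}. \<integral>\<^sup>+\<omega>. u n (restrict \<omega> {..<n}) * weight b k l p \<omega> \<partial>Pi\<^sub>M UNIV (\<lambda>_. p)) \<partial>q)"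
      unfolding I_def by (intro nn_integral_sum[symmetric] nn_integral_weight_measurable u)
    also have "\<dots> \<le> (\<integral>\<^sup>+p. ennreal (exp (l\<^sup>2 * b / 8)) \<partial>q)"
    proof (rule nn_integral_mono)
      fix p assume "p \<in> space q"
      then have p: "p \<in> space N" by (simp add: space_q)
      interpret p: prob_space p using p by (rule prob_space_law)
      have um: "(\<lambda>\<omega>. u n (restrict \<omega> {..<n})) \<in> borel_measurable (Pi\<^sub>M UNIV (\<lambda>_. p))" if "n \<in> {a..b}" for n
        using that by (intro borel_measurable_PiM_law[OF p] measurable_compose[OF restrict_measurable u]) auto
      have "(\<Sum>n\<in>{a..b}. \<integral>\<^sup>+\<omega>. u n (restrict \<omega> {..<n}) * weight b k l p \<omega> \<partial>Pi\<^sub>M UNIV (\<lambda>_. p))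
        = (\<integral>\<^sup>+\<omega>. (\<Sum>n\<in>{a..b}. u n (restrict \<omega> {..<n})) * weight b k l p \<omega> \<partial>Pi\<^sub>M UNIV (\<lambda>_. p))"
        unfolding sum_distrib_right
        by (intro nn_integral_sum[symmetric] borel_measurable_times_ennreal um weight_measurable_law[OF p])
      also have "\<dots> \<le> (\<integral>\<^sup>+\<omega>. 1 * weight b k l p \<omega> \<partial>Pi\<^sub>M UNIV (\<lambda>_. p))"
        by (intro nn_integral_mono mult_right_mono u_sum) auto
      also have "\<dots> \<le> ennreal (exp (l\<^sup>2 * b / 8))"
        using p.nn_integral_PiM_exp_centered_le[where l = l and N = b,
            OF f_measurable_law[OF p, of k] f_range_law[OF p, of _ k]]
        by (simp add: weight_def mean_def)
      finally show "(\<Sum>n\<in>{a..b}. \<integral>\<^sup>+\<omega>. u n (restrict \<omega> {..<n}) * weight b k l p \<omega> \<partial>Pi\<^sub>M UNIV (\<lambda>_. p))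
        \<le> ennreal (exp (l\<^sup>2 * b / 8))" .
    qed
    also have "\<dots> = ennreal (exp (l\<^sup>2 * b / 8))" by (simp add: q.emeasure_space_1)
    finally show ?thesis .
  qed
  have step: "(\<integral>\<^sup>+\<omega>. u n (restrict \<omega> {..<n}) * total n l (restrict \<omega> {..<n}) \<partial>\<rho>)
    \<le> (\<Sum>k. ennreal ((1/2) ^ Suc k) * (I n k l + I n k (- l)))" if n: "n \<in> {a..b}" for n
  proof -
    have n1: "1 \<le> n" using n \<open>1 \<le> a\<close> by auto
    let ?e = "\<lambda>l k \<omega>. u n (restrict \<omega> {..<n}) * expo n k l (restrict \<omega> {..<n})"
    have em: "?e l k \<in> borel_measurable \<rho>" for l k
      by (intro borel_measurable_times_ennreal measurable_compose[OF restrict_rho u[OF n]]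
          measurable_compose[OF restrict_rho expo_measurable[OF n1]])
    have "u n (restrict \<omega> {..<n}) * total n l (restrict \<omega> {..<n})
      = (\<Sum>k. ennreal ((1/2) ^ Suc k) * (?e l k \<omega> + ?e (- l) k \<omega>))" for \<omega>
      unfolding total_def ennreal_suminf_cmult[symmetric] distrib_left by (simp only: mult.left_commute)
    then have "(\<integral>\<^sup>+\<omega>. u n (restrict \<omega> {..<n}) * total n l (restrict \<omega> {..<n}) \<partial>\<rho>)
      = (\<integral>\<^sup>+\<omega>. (\<Sum>k. ennreal ((1/2) ^ Suc k) * (?e l k \<omega> + ?e (- l) k \<omega>)) \<partial>\<rho>)"
      by simp
    also have "\<dots> = (\<Sum>k. \<integral>\<^sup>+\<omega>. ennreal ((1/2) ^ Suc k) * (?e l k \<omega> + ?e (- l) k \<omega>) \<partial>\<rho>)"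
      by (intro nn_integral_suminf borel_measurable_times_ennreal borel_measurable_add em borel_measurable_const)
    also have "\<dots> = (\<Sum>k. ennreal ((1/2) ^ Suc k) * ((\<integral>\<^sup>+\<omega>. ?e l k \<omega> \<partial>\<rho>) + (\<integral>\<^sup>+\<omega>. ?e (- l) k \<omega> \<partial>\<rho>)))"
      by (intro suminf_cong, subst nn_integral_cmult[OF borel_measurable_add[OF em em]], subst nn_integral_add[OF em em]) simp
    also have "\<dots> \<le> (\<Sum>k. ennreal ((1/2) ^ Suc k) * (I n k l + I n k (- l)))"
      unfolding I_def using n
      by (intro suminf_le mult_left_mono add_mono nn_integral_expo_le[OF n1 _ u[OF n]] summableI) auto
    finally show ?thesis .
  qed
  have "\<Lambda> * emeasure \<rho> E = (\<integral>\<^sup>+\<omega>. \<Lambda> * indicator E \<omega> \<partial>\<rho>)"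
    using E by (simp add: nn_integral_cmult_indicator)
  also have "\<dots> \<le> (\<integral>\<^sup>+\<omega>. (\<Sum>n\<in>{a..b}. u n (restrict \<omega> {..<n}) * total n l (restrict \<omega> {..<n})) \<partial>\<rho>)"
    by (intro nn_integral_mono first)
  also have "\<dots> = (\<Sum>n\<in>{a..b}. \<integral>\<^sup>+\<omega>. u n (restrict \<omega> {..<n}) * total n l (restrict \<omega> {..<n}) \<partial>\<rho>)"
    by (intro nn_integral_sum borel_measurable_times_ennreal tot_rho measurable_compose[OF restrict_rho u])
  also have "\<dots> \<le> (\<Sum>n\<in>{a..b}. \<Sum>k. ennreal ((1/2) ^ Suc k) * (I n k l + I n k (- l)))"
    by (intro sum_mono step)
  also have "\<dots> = (\<Sum>k. ennreal ((1/2) ^ Suc k) * ((\<Sum>n\<in>{a..b}. I n k l) + (\<Sum>n\<in>{a..b}. I n k (- l))))"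
    by (subst suminf_sum[symmetric]) (auto simp: sum_distrib_left sum.distrib distrib_left)
  also have "\<dots> \<le> (\<Sum>k. ennreal ((1/2) ^ Suc k) * (2 * ennreal (exp (l\<^sup>2 * b / 8))))"
    using add_mono[OF I_sum[of _ l] I_sum[of _ "- l"]]
    by (intro suminf_le mult_left_mono summableI) (auto simp: mult_2)
  also have "\<dots> = 2 * ennreal (exp (l\<^sup>2 * b / 8))"
    unfolding ennreal_suminf_multc suminf_half by simp
  finally show ?thesis unfolding E_def .
qed

section \<open>The posterior spread and its exponential bound\<close>

definition spread :: "nat \<Rightarrow> nat \<Rightarrow> (nat \<Rightarrow> 'a) \<Rightarrow> real" where
  "spread n k x = (\<integral>p. \<bar>mean k p - (\<Sum>i<n. f k (x i)) / n\<bar> \<partial>post n x)"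

lemma
  assumes "n \<ge> 1" and x: "x \<in> space (Pi\<^sub>M {..<n} (\<lambda>_. M))"
  shows post_space: "space (post n x) = space N" and post_sets: "sets (post n x) = sets N"
    and post_prob_space: "prob_space (post n x)"
  using measurable_space[OF post_measurable x] assms(1) 
  by (auto simp: space_prob_algebra dest: sets_eq_imp_space_eq)

lemma average_range:
  assumes "n \<ge> (1::nat)" and x: "x \<in> space (Pi\<^sub>M {..<n} (\<lambda>_. M))"
  shows "(\<Sum>i<n. f k (x i)) / n \<in> {0..1}"
proof -
  have "f k (x i) \<in> {0..1}" if "i < n" for i
    using x that by (intro f_range) (auto simp: space_PiM)
  then have "0 \<le> (\<Sum>i<n. f k (x i))" "(\<Sum>i<n. f k (x i)) \<le> (\<Sum>i<n. 1)"
    by (intro sum_nonneg sum_mono; force)+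
  then show ?thesis using assms(1) by (simp add: field_simps)
qed

lemma spread_facts:
  assumes "n \<ge> 1" and x: "x \<in> space (Pi\<^sub>M {..<n} (\<lambda>_. M))"
  shows spread_integrable: "integrable (post n x) (\<lambda>p. \<bar>mean k p - (\<Sum>i<n. f k (x i)) / n\<bar>)"
    and spread_range: "spread n k x \<in> {0..1}"
proof -
  interpret P: prob_space "post n x" by (rule post_prob_space[OF assms])
  have [measurable_cong]: "sets (post n x) = sets N" by (rule post_sets[OF assms])
  have b: "\<bar>mean k p - (\<Sum>i<n. f k (x i)) / n\<bar> \<le> 1" if "p \<in> space (post n x)" for p
    using mean_range[of p k] that average_range[OF assms, of k] by (auto simp: post_space[OF assms])
  show i: "integrable (post n x) (\<lambda>p. \<bar>mean k p - (\<Sum>i<n. f k (x i)) / n\<bar>)"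
    using b by (intro P.integrable_const_bound[where B = 1]) auto
  have "spread n k x \<le> (\<integral>p. 1 \<partial>post n x)"
    unfolding spread_def using b i by (intro integral_mono) auto
  then show "spread n k x \<in> {0..1}"
    by (auto simp: P.prob_space spread_def)
qed

text \<open>The \<open>r\<^sub>n\<close> of the overview, with the index shifted as in
  \<open>total\<close>.\<close>

definition radius :: "nat \<Rightarrow> (nat \<Rightarrow> 'a) \<Rightarrow> real" where
  "radius n x = (\<Sum>k. (1/2) ^ Suc k * spread n k x)"

lemma summable_spread:
  assumes "n \<ge> 1" and x: "x \<in> space (Pi\<^sub>M {..<n} (\<lambda>_. M))"
  shows "summable (\<lambda>k. (1/2) ^ Suc k * spread n k x)"
  by (rule summable_comparison_test'[OF sums_summable[OF power_half_series], of 0])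
    (use spread_range[OF assms] in \<open>auto intro: mult_left_le\<close>)

text \<open>Jensen's inequality for the posterior and the weights at once, from the tangent line of the
  exponential at \<open>radius n x\<close>.\<close>

lemma exp_radius_le:
  assumes "n \<ge> 1" and x: "x \<in> space (Pi\<^sub>M {..<n} (\<lambda>_. M))" and "l \<ge> 0"
  shows "ennreal (exp (l * n * radius n x)) \<le> total n l x"
proof -
  interpret P: prob_space "post n x" by (rule post_prob_space[OF assms(1,2)])
  have [measurable_cong]: "sets (post n x) = sets N" by (rule post_sets[OF assms(1,2)])
  define r where "r = radius n x"
  define E where "E = exp (l * n * r)"
  \<comment> \<open>The tangent of the exponential at \<open>l * n * r\<close>, taken at
    \<open>l * n * spread n k x\<close>. The weights sum to 1 and average the spreads to
    \<open>r\<close>, so the weighted sum of the \<open>c k\<close> is exactly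
    \<open>E\<close>.\<close>
  define c where "c k = E * (1 + l * n * (spread n k x - r))" for k
  have c: "ennreal (c k) \<le> expo n k l x + expo n k (- l) x" for k
  proof -
    define s where "s = (\<Sum>i<n. f k (x i))"
    have ex: "expo n k l' x = (\<integral>\<^sup>+p. ennreal (exp (l' * (s - n * mean k p))) \<partial>post n x)" for l'
    proof -
      have "expo n k l' x = (\<integral>\<^sup>+p. (\<Prod>i<n. ennreal (exp (l' * f k (x i)))) * ennreal (exp (- (l' * n * mean k p))) \<partial>post n x)"
        unfolding expo_def by (simp add: nn_integral_cmult)
      also have "\<dots> = (\<integral>\<^sup>+p. ennreal (exp (l' * (s - n * mean k p))) \<partial>post n x)"
      proof (rule nn_integral_cong)
        fix p
        have "l' * s + - (l' * n * mean k p) = l' * (s - n * mean k p)"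
          by (simp add: right_diff_distrib)
        then show "(\<Prod>i<n. ennreal (exp (l' * f k (x i)))) * ennreal (exp (- (l' * n * mean k p)))
          = ennreal (exp (l' * (s - n * mean k p)))"
          by (simp only: prod_ennreal exp_ge_zero ennreal_mult[symmetric] exp_sum[symmetric]
              exp_add[symmetric] finite_lessThan s_def sum_distrib_left[symmetric])
      qed
      finally show ?thesis .
    qed
    have i: "integrable (post n x) (\<lambda>p. E * (1 + l * n * (\<bar>mean k p - s / n\<bar> - r)))"
      using spread_integrable[OF assms(1,2), of k] by (auto simp: s_def)
    have "c k = (\<integral>p. E * (1 + l * n * (\<bar>mean k p - s / n\<bar> - r)) \<partial>post n x)"
      using spread_integrable[OF assms(1,2), of k] by (simp add: c_def spread_def s_def P.prob_space)
    also have "ennreal \<dots> \<le> (\<integral>\<^sup>+p. ennreal (E * (1 + l * n * (\<bar>mean k p - s / n\<bar> - r))) \<partial>post n x)"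
      by (rule ennreal_integral_le_nn_integral[OF i])
    also have "\<dots> \<le> (\<integral>\<^sup>+p. ennreal (exp (l * (s - n * mean k p))) + ennreal (exp (- l * (s - n * mean k p))) \<partial>post n x)"
    proof (rule nn_integral_mono)
      fix p
      let ?d = "\<bar>mean k p - s / n\<bar>"
      have "E * (1 + l * n * (?d - r)) \<le> E * exp (l * n * (?d - r))"
        unfolding E_def by (intro mult_left_mono exp_ge_add_one_self) auto
      also have "\<dots> = exp (l * \<bar>s - n * mean k p\<bar>)"
      proof -
        have "n * ?d = \<bar>real n * (mean k p - s / n)\<bar>" by (simp add: abs_mult)
        also have "\<dots> = \<bar>s - n * mean k p\<bar>"
          using assms(1) by (simp add: right_diff_distrib abs_minus_commute)
        finally have "l * n * r + l * n * (?d - r) = l * \<bar>s - n * mean k p\<bar>"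
          by (simp add: algebra_simps)
        then show ?thesis unfolding E_def by (simp add: exp_add[symmetric])
      qed
      \<comment> \<open>The absolute value is split into both signs; this is why
        \<open>total\<close> carries \<open>l\<close> and \<open>- l\<close>, and the origin of the
        factor 2 in the maximal inequality.\<close>
      also have "\<dots> \<le> exp (l * (s - n * mean k p)) + exp (- l * (s - n * mean k p))"
      proof -
        have "exp (l * \<bar>t\<bar>) \<le> exp (l * t) + exp (- l * t)" for t
        proof (cases "t \<ge> 0")
          case False
          then have "l * \<bar>t\<bar> = - l * t" by simp
          then show ?thesis by (simp only:) simp
        qed simp
        then show ?thesis .
      qed
      finally show "ennreal (E * (1 + l * n * (?d - r)))
        \<le> ennreal (exp (l * (s - n * mean k p))) + ennreal (exp (- l * (s - n * mean k p)))"
        by (simp add: ennreal_plus[symmetric] del: ennreal_plus)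
    qed
    also have "\<dots> = expo n k l x + expo n k (- l) x"
      unfolding ex by (intro nn_integral_add) measurable
    finally show ?thesis .
  qed
  have s0: "(\<lambda>k. (1/2) ^ Suc k * spread n k x) sums r"
    unfolding r_def radius_def using summable_spread[OF assms(1,2)] by (rule summable_sums)
  have "(\<lambda>k. (E * (1 - l * n * r)) * (1/2) ^ Suc k + (E * l * n) * ((1/2) ^ Suc k * spread n k x))
      sums ((E * (1 - l * n * r)) * 1 + (E * l * n) * r)"
    by (intro sums_add sums_mult s0 power_half_series)
  also have "(\<lambda>k. (E * (1 - l * n * r)) * (1/2) ^ Suc k + (E * l * n) * ((1/2) ^ Suc k * spread n k x))
      = (\<lambda>k. (1/2) ^ Suc k * c k)"
    by (simp add: c_def fun_eq_iff algebra_simps del: power_Suc)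
  finally have sums: "(\<lambda>k. (1/2) ^ Suc k * c k) sums E" by (simp add: algebra_simps)
  \<comment> \<open>The \<open>c k\<close> may be negative, so the passage to \<open>ennreal\<close>
    goes through absolute summability.\<close>
  have "summable (\<lambda>k. \<bar>(1/2) ^ Suc k * c k\<bar>)"
  proof (rule summable_comparison_test')
    show "summable (\<lambda>k. (E * (1 + l * n * (1 + \<bar>r\<bar>))) * (1/2) ^ Suc k)"
      by (intro summable_mult sums_summable[OF power_half_series])
    fix k
    have "\<bar>spread n k x - r\<bar> \<le> 1 + \<bar>r\<bar>" using spread_range[OF assms(1,2), of k] by auto
    then have "\<bar>l * n * (spread n k x - r)\<bar> \<le> l * n * (1 + \<bar>r\<bar>)"
      unfolding abs_mult using \<open>l \<ge> 0\<close> by (auto intro!: mult_left_mono)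
    then have "\<bar>1 + l * n * (spread n k x - r)\<bar> \<le> 1 + l * n * (1 + \<bar>r\<bar>)" by linarith
    then have "\<bar>c k\<bar> \<le> E * (1 + l * n * (1 + \<bar>r\<bar>))"
      unfolding c_def abs_mult E_def by (auto intro!: mult_left_mono)
    then show "norm \<bar>(1/2) ^ Suc k * c k\<bar> \<le> (E * (1 + l * n * (1 + \<bar>r\<bar>))) * (1/2) ^ Suc k"
      by (simp add: abs_mult mult.commute[of "1/2"])
  qed
  from ennreal_suminf_le[OF this] have "ennreal E \<le> (\<Sum>k. ennreal ((1/2) ^ Suc k * c k))"
    using sums_unique[OF sums] by simp
  also have "\<dots> \<le> (\<Sum>k. ennreal ((1/2) ^ Suc k) * (expo n k l x + expo n k (- l) x))"
    by (intro suminf_le summableI) (simp add: ennreal_mult' mult_left_mono c del: power_Suc)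
  finally show ?thesis unfolding total_def E_def r_def .
qed

section \<open>Borel-Cantelli over dyadic blocks\<close>

lemma total_exceedance_sets:
  assumes "1 \<le> a"
  shows "{\<omega> \<in> space \<rho>. \<exists>n\<in>{a..b}. \<Lambda> \<le> total n l (restrict \<omega> {..<n})} \<in> sets \<rho>"
proof -
  have [measurable]: "(\<lambda>\<omega>. total n l (restrict \<omega> {..<n})) \<in> borel_measurable \<rho>" if "n \<in> {a..b}" for n
    using that assms by (intro measurable_compose[OF restrict_rho total_measurable]) auto
  show ?thesis by measurable
qed

lemma AE_radius_le:
  "AE \<omega> in \<rho>. eventually (\<lambda>n. n * radius n (restrict \<omega> {..<n}) \<le> sqrt (2 * real n * ln (ln n))) sequentially"
proof -
  interpret rho: prob_space \<rho> by (rule prob_space_rho)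
  \<comment> \<open>The iterated logarithm of \<open>2 ^ j\<close>, the left end of the block;
    \<open>N j\<close> is the right end.\<close>
  define L where "L j = ln (real j * ln 2)" for j
  define N where "N j = real (2 ^ Suc j)" for j
  \<comment> \<open>The minimizer of \<open>l\<^sup>2 * N j / 8 - l * sqrt (N j * L j)\<close>.
    There the moment bound has exponent \<open>2 * L j\<close>, and
    \<open>l * sqrt (N j * L j)\<close> equals \<open>4 * L j\<close>, whence the level in
    \<open>B\<close>.\<close>
  define l where "l j = 4 * sqrt (N j * L j) / N j" for j
  define B where "B j = {\<omega> \<in> space \<rho>. \<exists>n\<in>{2 ^ j..2 ^ Suc j}. ennreal (exp (4 * L j)) \<le> total n (l j) (restrict \<omega> {..<n})}" for j
  have ln2: "1 / 2 \<le> ln (2::real)" using ln_le_minus_one[of "1 / 2 :: real"] by (simp add: ln_div)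
  have N: "N j > 0" for j by (simp add: N_def)
  \<comment> \<open>From \<open>j = 3\<close> on, \<open>ln 2 \<ge> 1 / 2\<close> gives
    \<open>j * ln 2 > 1\<close>, which makes \<open>L j\<close> positive.\<close>
  have jln: "1 < real j * ln 2" if "j \<ge> 3" for j
  proof -
    have "1 < 3 * (1 / 2 :: real)" by simp
    also have "\<dots> \<le> real j * ln 2" using that ln2 by (intro mult_mono) auto
    finally show ?thesis .
  qed
  have L: "L j > 0" if "j \<ge> 3" for j using jln[OF that] by (simp add: L_def)
  have lN: "(l j)\<^sup>2 * N j / 8 = 2 * L j" if "j \<ge> 3" for j
    using L[OF that] N[of j] by (simp add: l_def power_divide power_mult_distrib power2_eq_square)
  have B_sets: "B j \<in> sets \<rho>" for j
    unfolding B_def by (rule total_exceedance_sets) simp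
  have B_le: "measure \<rho> (B j) \<le> (2 / (ln 2)\<^sup>2) * inverse (real j ^ 2)" if j: "j \<ge> 3" for j
  proof -
    have "ennreal (exp (4 * L j)) * emeasure \<rho> (B j) \<le> 2 * ennreal (exp ((l j)\<^sup>2 * real (2 ^ Suc j) / 8))"
      unfolding B_def by (rule total_maximal) simp
    also have "(l j)\<^sup>2 * real (2 ^ Suc j) / 8 = 2 * L j" using lN[OF j] unfolding N_def .
    finally have "exp (4 * L j) * measure \<rho> (B j) \<le> 2 * exp (2 * L j)"
      by (simp add: rho.emeasure_eq_measure ennreal_mult'[symmetric] numeral_mult_ennreal)
    then have "measure \<rho> (B j) \<le> 2 * exp (2 * L j) / exp (4 * L j)"
      by (simp add: field_simps)
    also have "\<dots> = 2 * inverse (exp (L j) ^ 2)"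
    proof -
      have "4 * L j = 2 * L j + 2 * L j" by simp
      then have "exp (4 * L j) = exp (2 * L j) * exp (2 * L j)" by (metis exp_add)
      then show ?thesis unfolding exp_double by (simp add: field_simps)
    qed
    also have "exp (L j) = real j * ln 2" using jln[OF j] by (simp add: L_def)
    finally show ?thesis by (simp add: power_mult_distrib field_simps)
  qed
  have "summable (\<lambda>j. measure \<rho> (B j))"
  proof (rule summable_comparison_test')
    show "summable (\<lambda>j. (2 / (ln 2)\<^sup>2) * inverse (real j ^ 2))"
      by (intro summable_mult inverse_power_summable) auto
    show "norm (measure \<rho> (B j)) \<le> (2 / (ln 2)\<^sup>2) * inverse (real j ^ 2)" if "j \<ge> 3" for j
      using B_le[OF that] by simp
  qed
  then have "AE \<omega> in \<rho>. eventually (\<lambda>j. \<omega> \<in> space \<rho> - B j) sequentially"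
    by (intro borel_cantelli_AE1 B_sets) (auto simp: rho.emeasure_eq_measure)
  then show ?thesis
  proof eventually_elim
    case (elim \<omega>)
    then obtain J where J: "\<And>j. j \<ge> J \<Longrightarrow> \<omega> \<in> space \<rho> - B j"
      by (auto simp: eventually_sequentially)
    show ?case
      unfolding eventually_sequentially
    proof (intro exI allI impI)
      fix n :: nat assume n: "n \<ge> 2 ^ max J 3"
      then have "1 \<le> n" using one_le_power[of "2::nat"] by (meson le_trans one_le_numeral)
      obtain j where j: "2 ^ j \<le> n" "n < 2 ^ Suc j"
        using ex_power_ivl1[of 2 n] \<open>1 \<le> n\<close> by auto
      have "max J 3 \<le> j"
      proof (rule ccontr)
        assume "\<not> max J 3 \<le> j"
        then have "(2::nat) ^ Suc j \<le> 2 ^ max J 3" by (intro power_increasing) auto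
        with n j show False by linarith
      qed
      then have j3: "j \<ge> 3" and jJ: "j \<ge> J" by auto
      define R where "R = radius n (restrict \<omega> {..<n})"
      have "\<omega> \<in> space \<rho>" "\<omega> \<notin> B j" using J[OF jJ] by auto
      then have lt: "total n (l j) (restrict \<omega> {..<n}) < ennreal (exp (4 * L j))"
        unfolding B_def using j by (force simp: not_le)
      have "l j \<ge> 0" using L[OF j3] N[of j] by (simp add: l_def)
      from exp_radius_le[OF \<open>1 \<le> n\<close> measurable_space[OF restrict_rho \<open>\<omega> \<in> space \<rho>\<close>] this]
      have "ennreal (exp (l j * n * R)) < ennreal (exp (4 * L j))"
        unfolding R_def using lt by (rule le_less_trans)
      then have "l j * (n * R) < 4 * L j" by (simp add: ennreal_less_iff mult.assoc)
      then have "sqrt (N j * L j) * (n * R) < N j * L j"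
        using N[of j] by (simp add: l_def field_simps)
      also have "\<dots> = sqrt (N j * L j) * sqrt (N j * L j)"
        using N[of j] L[OF j3] by simp
      finally have "n * R < sqrt (N j * L j)"
        by (rule mult_left_less_imp_less) (use N[of j] L[OF j3] in simp)
      \<comment> \<open>The price of the block: its right end is at most \<open>2 * n\<close> and
        its left end at most \<open>n\<close>, which yields the factor 2 and the iterated logarithm
        of \<open>n\<close>.\<close>
      also have "sqrt (N j * L j) \<le> sqrt (2 * real n * ln (ln n))"
      proof (rule real_sqrt_le_mono, rule mult_mono)
        have "real (2 ^ j) \<le> real n" using j(1) by (rule of_nat_mono)
        then show "N j \<le> 2 * real n" by (simp add: N_def)
        have "real j * ln 2 = ln (2 ^ j)" by (simp add: ln_realpow)
        also have "\<dots> \<le> ln n" using \<open>real (2 ^ j) \<le> real n\<close> by (intro ln_mono) auto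
        finally show "L j \<le> ln (ln n)"
          unfolding L_def using jln[OF j3] by (intro ln_mono) auto
      qed (use L[OF j3] in auto)
      finally show "n * radius n (restrict \<omega> {..<n}) \<le> sqrt (2 * real n * ln (ln n))"
        unfolding R_def by simp
    qed
  qed
qed

text \<open>Kept as an eventual inequality instead of a limit superior, so that it passes to every
  quantity dominated by a multiple of \<open>radius\<close>.\<close>

lemma AE_normalized_radius_le:
  "AE \<omega> in \<rho>. eventually (\<lambda>n. sqrt (n / ln (ln n)) * radius n (restrict \<omega> {..<n}) \<le> sqrt 2) sequentially"
  using AE_radius_le
proof eventually_elim
  case (elim \<omega>)
  \<comment> \<open>\<open>sqrt\<close> is an odd function, so the normalizing factor is negative
    where \<open>ln (ln n)\<close> is; once this is positive, multiplication by the factor preserves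
    inequalities.\<close>
  have "filterlim (\<lambda>n::nat. ln (ln (real n))) at_top sequentially"
    by (intro filterlim_compose[OF ln_at_top] filterlim_real_sequentially)
  then have "eventually (\<lambda>n::nat. ln (ln (real n)) > 0) sequentially"
    by (rule eventually_compose_filterlim[OF eventually_gt_at_top])
  with elim eventually_gt_at_top[of 0] show ?case
  proof eventually_elim
    case (elim n)
    define K where "K = ln (ln (real n))"
    have K: "K > 0" and n: "n > 0" using elim by (simp_all add: K_def)
    have "radius n (restrict \<omega> {..<n}) \<le> sqrt (2 * real n * K) / n"
      using elim(1) n unfolding K_def by (simp add: field_simps)
    then have "sqrt (n / K) * radius n (restrict \<omega> {..<n}) \<le> sqrt (n / K) * (sqrt (2 * real n * K) / n)"
      using K by (intro mult_left_mono) auto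
    also have "\<dots> = sqrt (n / K * (2 * real n * K)) / n" by (simp only: real_sqrt_mult[symmetric] times_divide_eq_right)
    also have "n / K * (2 * real n * K) = 2 * (real n)\<^sup>2" using K by (simp add: power2_eq_square)
    also have "sqrt \<dots> / n = sqrt 2" using n by (simp add: real_sqrt_mult)
    finally show ?case unfolding K_def .
  qed
qed

end

section \<open>Weak topology and weak distances\<close>

lemma space_borel_of [simp]: "space (borel_of T) = topspace T"
  by (simp add: borel_of_def space_measure_of_conv)

lemma sets_borel_of: "sets (borel_of T) = sigma_sets (topspace T) {U. openin T U}"
  unfolding borel_of_def using openin_subset by (intro sets_measure_of) blast

lemma openin_sets_borel_of: "openin T U \<Longrightarrow> U \<in> sets (borel_of T)"
  unfolding sets_borel_of by (rule sigma_sets.Basic) simp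

lemma continuous_map_borel_of:
  assumes "continuous_map T euclideanreal f" shows "f \<in> borel_measurable (borel_of T)"
proof (rule borel_measurableI)
  fix S :: "real set" assume "open S"
  then have "openin T {x \<in> topspace T. f x \<in> S}"
    using openin_continuous_map_preimage[OF assms, of S] by simp
  moreover have "f -` S \<inter> space (borel_of T) = {x \<in> topspace T. f x \<in> S}" by auto
  ultimately show "f -` S \<inter> space (borel_of T) \<in> sets (borel_of T)" by (simp add: openin_sets_borel_of)
qed

text \<open>A generated topology lives on the union of its subbasis; the zero test function with all
  reals as target makes the full set of probability measures subbasic.\<close>

lemma topspace_weak_topology [simp]: "topspace (weak_topology T) = space (prob_algebra (borel_of T))"
proof -
  have "space (prob_algebra (borel_of T)) = {\<mu> \<in> space (prob_algebra (borel_of T)). (\<integral>x. 0 \<partial>\<mu>) \<in> (UNIV :: real set)}"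
    by simp
  then have "space (prob_algebra (borel_of T)) \<in> {{\<mu> \<in> space (prob_algebra (borel_of T)). (\<integral>x. f x \<partial>\<mu>) \<in> U} | f U.
        continuous_map T euclideanreal f \<and> bounded (f ` topspace T) \<and> open U}"
    by (intro CollectI exI[where x = "\<lambda>_. 0"] exI[where x = UNIV] conjI) (auto simp: bounded_iff)
  then show ?thesis
    unfolding weak_topology_def topology_generated_by_topspace by blast
qed

lemma continuous_map_integral:
  assumes "continuous_map T euclideanreal f" "bounded (f ` topspace T)"
  shows "continuous_map (weak_topology T) euclideanreal (\<lambda>\<mu>. \<integral>x. f x \<partial>\<mu>)"
  unfolding continuous_map_def
proof (intro conjI allI impI)
  fix U :: "real set" assume "openin euclideanreal U"
  then have "open U" by simp
  then show "openin (weak_topology T) {\<mu> \<in> topspace (weak_topology T). (\<integral>x. f x \<partial>\<mu>) \<in> U}"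
    unfolding topspace_weak_topology unfolding weak_topology_def
    using assms by (intro topology_generated_by_Basis) blast
qed simp

lemma limitin_weak_topology_integral:
  assumes "limitin (weak_topology T) \<mu>s \<mu> F"
    and "continuous_map T euclideanreal f" "bounded (f ` topspace T)"
  shows "((\<lambda>n. \<integral>x. f x \<partial>\<mu>s n) \<longlongrightarrow> (\<integral>x. f x \<partial>\<mu>)) F"
  using continuous_map_limit[OF continuous_map_integral[OF assms(2,3)] assms(1)] by (simp add: o_def)

text \<open>The indicator of \<open>U\<close> is a pointwise limit of bounded continuous functions,
  so its integral is a limit of weakly continuous functionals.\<close>

lemma emeasure_open_weak_measurable:
  fixes X :: "'a::metric_space set"
  assumes U: "openin (top_of_set X) U"
  shows "(\<lambda>p. emeasure p U) \<in> borel_measurable (borel_of (weak_topology (top_of_set X)))"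
proof -
  obtain V where V: "open V" "U = X \<inter> V" using U by (auto simp: openin_open)
  \<comment> \<open>A multiple of the distance to the complement, truncated at 1. For
    \<open>V = UNIV\<close> the complement is empty and \<open>infdist\<close> would be 0 instead of
    infinite, hence the separate case.\<close>
  define f where "f n x = (if V = UNIV then 1 else min 1 (real n * infdist x (- V)))" for n :: nat and x
  have cont: "continuous_map (top_of_set X) euclideanreal (f n)" for n
    unfolding f_def by (cases "V = UNIV") (auto intro!: continuous_intros)
  have f01: "0 \<le> f n x" "f n x \<le> 1" for n x
    by (auto simp: f_def infdist_nonneg)
  have bnd: "bounded (f n ` topspace (top_of_set X))" for n
    unfolding bounded_iff using f01 by (intro exI[of _ 1]) auto
  have meas: "(\<lambda>p. \<integral>x. f n x \<partial>p) \<in> borel_measurable (borel_of (weak_topology (top_of_set X)))" for n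
    by (intro continuous_map_borel_of continuous_map_integral cont bnd)
  have lim: "(\<lambda>n. f n x) \<longlonglongrightarrow> indicator V x" for x
  proof (cases "x \<in> V \<and> V \<noteq> UNIV")
    case True
    then have pos: "infdist x (- V) > 0"
      using V(1) in_closed_iff_infdist_zero[of "- V" x] infdist_nonneg[of x "- V"] by (auto simp: closed_def less_le)
    obtain N where N: "1 / infdist x (- V) < real N" using reals_Archimedean2 by blast
    have "f n x = 1" if "n \<ge> N" for n
    proof -
      have "1 < real N * infdist x (- V)" using N pos by (simp add: field_simps)
      also have "\<dots> \<le> real n * infdist x (- V)" using that pos by (intro mult_right_mono) auto
      finally show ?thesis using True by (simp add: f_def)
    qed
    then have "eventually (\<lambda>n. f n x = indicator V x) sequentially"
      using True by (auto simp: eventually_sequentially)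
    then show ?thesis by (rule tendsto_eventually)
  next
    case False
    then have "f n x = indicator V x" for n by (auto simp: f_def)
    then show ?thesis by simp
  qed
  have "(\<lambda>n. \<integral>x. f n x \<partial>p) \<longlonglongrightarrow> measure p U" if "p \<in> space (prob_algebra (borel_of (top_of_set X)))" for p
  proof -
    have sp: "sets p = sets (borel_of (top_of_set X))" and p: "prob_space p" using that by (auto simp: space_prob_algebra)
    interpret prob_space p by fact
    have spX: "space p = X" using sets_eq_imp_space_eq[OF sp] by simp
    have mf: "f n \<in> borel_measurable p" for n
      using continuous_map_borel_of[OF cont] measurable_cong_sets[OF sp refl] by blast
    have Up: "U \<in> sets p" using openin_sets_borel_of[OF U] sp by simp
    have "(\<lambda>n. \<integral>x. f n x \<partial>p) \<longlonglongrightarrow> (\<integral>x. indicator U x \<partial>p)"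
    proof (rule integral_dominated_convergence[where w = "\<lambda>_. 1"])
      show "AE x in p. (\<lambda>n. f n x) \<longlonglongrightarrow> indicator U x"
      proof (rule AE_I2)
        fix x assume "x \<in> space p"
        then have "indicator U x = (indicator V x :: real)" using spX V by (simp add: indicator_def)
        then show "(\<lambda>n. f n x) \<longlonglongrightarrow> indicator U x" using lim by simp
      qed
    qed (use mf Up f01 in auto)
    then show ?thesis using Up by simp
  qed
  then have "(\<lambda>p. measure p U) \<in> borel_measurable (borel_of (weak_topology (top_of_set X)))"
    by (intro borel_measurable_LIMSEQ_real[OF _ meas]) simp
  then have "(\<lambda>p. ennreal (measure p U)) \<in> borel_measurable (borel_of (weak_topology (top_of_set X)))"
    by simp
  then show ?thesis
  proof (rule measurable_cong[THEN iffD1, rotated])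
    fix p assume "p \<in> space (borel_of (weak_topology (top_of_set X)))"
    then interpret prob_space p by (simp add: space_prob_algebra)
    show "ennreal (measure p U) = emeasure p U" by (simp add: emeasure_eq_measure)
  qed
qed

text \<open>Open sets form an intersection-stable generator, so measurability of evaluation on them
  suffices. Random elements of the weak topology can thus serve as kernels.\<close>

lemma id_measurable_weak_topology:
  fixes X :: "'a::metric_space set"
  shows "(\<lambda>p. p) \<in> borel_of (weak_topology (top_of_set X)) \<rightarrow>\<^sub>M prob_algebra (borel_of (top_of_set X))"
  by (rule measurable_prob_algebra_generated[OF sets_borel_of _ _ _ _ emeasure_open_weak_measurable])
    (auto simp: space_prob_algebra Int_stable_def dest: openin_imp_subset)

lemma lipschitz_wrt_continuous_map:
  assumes "Metric_space X d" "Metric_space.mtopology X d = T" "lipschitz_wrt X d f"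
  shows "continuous_map T euclideanreal f"
proof -
  interpret Metric_space X d by fact
  obtain L where L: "\<And>x y. x \<in> X \<Longrightarrow> y \<in> X \<Longrightarrow> \<bar>f x - f y\<bar> \<le> L * d x y"
    using assms(3) unfolding lipschitz_wrt_def by blast
  have "continuous_map mtopology euclideanreal f"
    unfolding continuous_map_def
  proof (intro conjI allI impI)
    fix U :: "real set" assume "openin euclideanreal U"
    then have U: "open U" by simp
    show "openin mtopology {x \<in> topspace mtopology. f x \<in> U}"
      unfolding openin_mtopology
    proof (intro conjI allI impI)
      fix x assume "x \<in> {x \<in> topspace mtopology. f x \<in> U}"
      then have x: "x \<in> X" "f x \<in> U" by auto
      then obtain e where e: "e > 0" "\<And>y. \<bar>y - f x\<bar> < e \<Longrightarrow> y \<in> U"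
        using U by (auto simp: open_dist dist_real_def)
      \<comment> \<open>The sign of \<open>L\<close> is unspecified;
        \<open>\<bar>L\<bar> + 1\<close> is an upper bound that is positive and may be divided
        by.\<close>
      have "mball x (e / (\<bar>L\<bar> + 1)) \<subseteq> {x \<in> topspace mtopology. f x \<in> U}"
      proof
        fix y assume "y \<in> mball x (e / (\<bar>L\<bar> + 1))"
        then have y: "y \<in> X" "d y x < e / (\<bar>L\<bar> + 1)" by (auto simp: commute)
        have "\<bar>f y - f x\<bar> \<le> L * d y x" using L y x by blast
        also have "\<dots> \<le> (\<bar>L\<bar> + 1) * d y x" by (intro mult_right_mono) auto
        also have "\<dots> < e" using y(2) by (simp add: field_simps)
        finally show "y \<in> {x \<in> topspace mtopology. f x \<in> U}" using e(2) y(1) by simp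
      qed
      then show "\<exists>r>0. mball x r \<subseteq> {x \<in> topspace mtopology. f x \<in> U}"
        using e(1) by (intro exI[of _ "e / (\<bar>L\<bar> + 1)"]) auto
    qed auto
  qed auto
  with assms(2) show ?thesis by simp
qed

section \<open>Bounded-Lipschitz normalization and the series of the weak distance\<close>

context
  fixes S :: "'b set" and D :: "'b \<Rightarrow> 'b \<Rightarrow> real" and f :: "'b \<Rightarrow> real"
  assumes D: "\<And>x y. x \<in> S \<Longrightarrow> y \<in> S \<Longrightarrow> 0 \<le> D x y"
    and f: "f \<in> S \<rightarrow> {0..1}" "lipschitz_wrt S D f"
begin

text \<open>The norm dominates both the supremum and the Lipschitz quotients of \<open>f\<close>, so
  division by it leaves a function bounded by 1 and 1-Lipschitz. \<open>D\<close> is an arbitrary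
  nonnegative function, so that the bounds serve the given metric and \<open>weak_dist\<close>
  alike.\<close>

lemma BL_normalize_bounds:
  assumes x: "x \<in> S"
  shows BL_normalize_range: "BL_normalize S D f x \<in> {0..1}"
    and BL_normalize_lipschitz: "y \<in> S \<Longrightarrow> \<bar>BL_normalize S D f x - BL_normalize S D f y\<bar> \<le> D x y"
proof -
  obtain L where L: "\<And>x y. x \<in> S \<Longrightarrow> y \<in> S \<Longrightarrow> \<bar>f x - f y\<bar> \<le> L * D x y"
    using f(2) unfolding lipschitz_wrt_def by blast
  define A where "A = (SUP x\<in>S. \<bar>f x\<bar>)"
  define B where "B = (SUP (x, y)\<in>S \<times> S. \<bar>f x - f y\<bar> / D x y)"
  define c where "c = BL_norm S D f"
  have c: "c = A + B" by (simp add: c_def A_def B_def BL_norm_def)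
  have bA: "bdd_above ((\<lambda>x. \<bar>f x\<bar>) ` S)"
    using f(1) by (intro bdd_aboveI[of _ 1]) (auto simp: Pi_iff)
  have q: "\<bar>f x - f y\<bar> / D x y \<le> \<bar>L\<bar>" if "x \<in> S" "y \<in> S" for x y
  proof (cases "D x y = 0")
    case False
    then have "D x y > 0" using D[OF that] by simp
    moreover have "\<bar>f x - f y\<bar> \<le> \<bar>L\<bar> * D x y"
      using L[OF that] D[OF that] by (meson abs_ge_self mult_right_mono order_trans)
    ultimately show ?thesis by (simp add: field_simps)
  qed simp
  have bB: "bdd_above ((\<lambda>(x, y). \<bar>f x - f y\<bar> / D x y) ` (S \<times> S))"
    using q by (intro bdd_aboveI[of _ "\<bar>L\<bar>"]) auto
  have fA: "\<bar>f x\<bar> \<le> A" if "x \<in> S" for x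
    unfolding A_def by (rule cSUP_upper[OF that bA])
  have fB: "\<bar>f x - f y\<bar> / D x y \<le> B" if "x \<in> S" "y \<in> S" for x y
    unfolding B_def using cSUP_upper[OF _ bB, of "(x, y)"] that by simp
  have A0: "0 \<le> A" using fA[OF x] by (rule order_trans[OF abs_ge_zero])
  have B0: "0 \<le> B" using fB[OF x x] D[OF x x] by simp
  have fc: "0 \<le> f x" "f x \<le> c" using fA[OF x] f(1) x B0 by (auto simp: c)
  then show "BL_normalize S D f x \<in> {0..1}"
    using A0 B0 unfolding BL_normalize_def c_def[symmetric] by (auto simp: divide_le_eq c)
  assume y: "y \<in> S"
  have "\<bar>f x - f y\<bar> \<le> c * D x y"
  \<comment> \<open>Where \<open>D x y = 0\<close> the quotient is 0 by convention and carries no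
    information; there the Lipschitz bound itself forces \<open>f x = f y\<close>.\<close>
  proof (cases "D x y = 0")
    case True
    then show ?thesis using L[OF x y] by simp
  next
    case False
    then have pos: "D x y > 0" using D[OF x y] by simp
    then have "\<bar>f x - f y\<bar> \<le> B * D x y" using fB[OF x y] by (simp add: field_simps)
    also have "\<dots> \<le> c * D x y" using A0 pos by (intro mult_right_mono) (auto simp: c)
    finally show ?thesis .
  qed
  moreover have "\<bar>BL_normalize S D f x - BL_normalize S D f y\<bar> = \<bar>f x - f y\<bar> / \<bar>c\<bar>"
    by (simp add: BL_normalize_def c_def diff_divide_distrib[symmetric] abs_divide)
  ultimately show "\<bar>BL_normalize S D f x - BL_normalize S D f y\<bar> \<le> D x y"
    using A0 B0 D[OF x y] by (cases "c = 0") (auto simp: c divide_le_eq mult.commute abs_if)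
qed

end

lemma weak_dist_nonneg: "0 \<le> weak_dist T D g \<mu> \<nu>"
  unfolding weak_dist_def by (intro infsum_nonneg) auto

text \<open>The bound \<open>C\<close> makes the series summable; otherwise \<open>infsum\<close>
  would be 0 by convention. The index is shifted to start at 0, where
  \<open>power_half_series\<close> applies.\<close>

lemma weak_dist_sums:
  fixes T :: "'a topology" and D g \<mu> \<nu>
  defines "t \<equiv> \<lambda>k. \<bar>(\<integral>x. BL_normalize (topspace T) D (g k) x \<partial>\<mu>) - (\<integral>x. BL_normalize (topspace T) D (g k) x \<partial>\<nu>)\<bar>"
  assumes bound: "\<And>k. t (Suc k) \<le> C"
  shows "(\<lambda>k. (1 / 2) ^ Suc k * t (Suc k)) sums weak_dist T D g \<mu> \<nu>"
proof -
  have "summable (\<lambda>k. (1 / 2) ^ Suc k * t (Suc k))"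
  proof (rule summable_comparison_test')
    show "summable (\<lambda>k. C * (1 / 2) ^ Suc k)" by (intro summable_mult sums_summable[OF power_half_series])
    show "norm ((1 / 2) ^ Suc k * t (Suc k)) \<le> C * (1 / 2) ^ Suc k" if "k \<ge> 0" for k
      using bound[of k] by (simp add: t_def abs_mult mult_right_mono mult.commute)
  qed
  then obtain s where s: "(\<lambda>k. (1 / 2) ^ Suc k * t (Suc k)) sums s" unfolding summable_def by blast
  then have "((\<lambda>k. (1 / 2) ^ Suc k * t (Suc k)) has_sum s) UNIV"
    by (rule sums_nonneg_imp_has_sum) (simp add: t_def)
  then have "s = (\<Sum>\<^sub>\<infinity>k. (1 / 2) ^ Suc k * t (Suc k))" by (simp add: infsumI)
  also have "\<dots> = (\<Sum>\<^sub>\<infinity>k\<in>range Suc. (1 / 2) ^ k * t k)"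
    by (simp add: infsum_reindex o_def)
  also have "range Suc = {1..}" by (auto simp: image_iff Suc_le_D)
  finally show ?thesis using s by (simp add: weak_dist_def t_def power_one_over)
qed

lemma BL_normalize_continuous_map:
  assumes "continuous_map T euclideanreal f"
  shows "continuous_map T euclideanreal (BL_normalize S D f)"
proof -
  have "BL_normalize S D f = (\<lambda>x. inverse (BL_norm S D f) * f x)"
    by (auto simp: BL_normalize_def divide_inverse mult.commute)
  then show ?thesis using continuous_map_real_mult_left[OF assms] by simp
qed

text \<open>As the image of the uniform law on the indices, the empirical measure counts repeated
  sample points with multiplicity, and integrals against it become averages.\<close>

lemma empirical_measure_eq_distr:
  assumes "\<And>i. i < n \<Longrightarrow> \<omega> i \<in> topspace T" "n \<ge> 1"
  shows "empirical_measure T n \<omega> = distr (uniform_count_measure {..<n}) (borel_of T) \<omega>"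
proof -
  let ?D = "distr (uniform_count_measure {..<n}) (borel_of T) \<omega>"
  have m: "\<omega> \<in> uniform_count_measure {..<n} \<rightarrow>\<^sub>M borel_of T"
    using assms(1) by (auto simp: measurable_def space_uniform_count_measure sets_uniform_count_measure)
  have "(\<Sum>i<n. emeasure (return (borel_of T) (\<omega> i)) A) / of_nat n = emeasure ?D A"
    if A: "A \<in> sets (borel_of T)" for A
  proof -
    have "(\<Sum>i<n. emeasure (return (borel_of T) (\<omega> i)) A) = (\<Sum>i<n. indicator (\<omega> -` A) i)"
      using A by (intro sum.cong) (auto simp: indicator_def)
    also have "\<dots> = of_nat (card ({..<n} \<inter> \<omega> -` A))"
      unfolding indicator_def by (simp add: sum_of_bool_eq vimage_def)
    finally have "(\<Sum>i<n. emeasure (return (borel_of T) (\<omega> i)) A) / of_nat n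
      = ennreal (real (card ({..<n} \<inter> \<omega> -` A)) / real n)"
      using assms(2) by (simp add: divide_ennreal[symmetric] ennreal_of_nat_eq_real_of_nat)
    also have "\<dots> = emeasure ?D A"
      using m A by (simp add: emeasure_distr emeasure_uniform_count_measure space_uniform_count_measure Int_commute)
    finally show ?thesis .
  qed
  then have "empirical_measure T n \<omega> = measure_of (space (borel_of T)) (sets (borel_of T)) (emeasure ?D)"
    unfolding empirical_measure_def
    by (intro measure_of_eq sets.space_closed) (simp only: sets.sigma_sets_eq)
  also have "\<dots> = ?D" using measure_of_of_measure[of ?D] by simp
  finally show ?thesis .
qed

lemma
  fixes f :: "'a \<Rightarrow> real"
  assumes "\<And>i. i < n \<Longrightarrow> \<omega> i \<in> topspace T" "n \<ge> 1"
  shows empirical_measure_prob_algebra: "empirical_measure T n \<omega> \<in> space (prob_algebra (borel_of T))"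
    and integral_empirical_measure: "f \<in> borel_measurable (borel_of T) \<Longrightarrow>
      (\<integral>x. f x \<partial>empirical_measure T n \<omega>) = (\<Sum>i<n. f (\<omega> i)) / real n"
proof -
  have m: "\<omega> \<in> uniform_count_measure {..<n} \<rightarrow>\<^sub>M borel_of T"
    using assms(1) by (auto simp: measurable_def space_uniform_count_measure sets_uniform_count_measure)
  have eq: "empirical_measure T n \<omega> = distr (uniform_count_measure {..<n}) (borel_of T) \<omega>"
    using assms by (rule empirical_measure_eq_distr)
  have "prob_space (uniform_count_measure {..<n})"
    using assms(2) by (intro prob_space_uniform_count_measure) (auto simp: lessThan_empty_iff)
  then show "empirical_measure T n \<omega> \<in> space (prob_algebra (borel_of T))"
    unfolding eq using m
    by (simp add: space_prob_algebra prob_space.prob_space_distr)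
  show "(\<integral>x. f x \<partial>empirical_measure T n \<omega>) = (\<Sum>i<n. f (\<omega> i)) / real n" if "f \<in> borel_measurable (borel_of T)"
    unfolding eq using m that
    by (simp add: integral_distr integral_uniform_count_measure)
qed

text \<open>\<open>measure_of\<close> keeps a given set function only if that is a measure on the
  sigma-algebra. The bind is one and has the same values, so the mixture inherits the calculus of
  kernels.\<close>

lemma iid_mixture_eq_bind:
  fixes X :: "'a::metric_space set"
  assumes Q: "Q \<in> space (prob_algebra (borel_of (weak_topology (top_of_set X))))"
  shows "iid_mixture (top_of_set X) I Q = Q \<bind> (\<lambda>p. Pi\<^sub>M I (\<lambda>_. p))"
proof -
  let ?P = "Pi\<^sub>M I (\<lambda>_. borel_of (top_of_set X))"
  have K: "(\<lambda>p. Pi\<^sub>M I (\<lambda>_. p)) \<in> borel_of (weak_topology (top_of_set X)) \<rightarrow>\<^sub>M prob_algebra ?P"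
    using measurable_compose[OF id_measurable_weak_topology measurable_PiM_power] .
  have s: "sets (Q \<bind> (\<lambda>p. Pi\<^sub>M I (\<lambda>_. p))) = sets ?P" by (rule sets_bind'[OF Q K])
  have "iid_mixture (top_of_set X) I Q = measure_of (space ?P) (sets ?P) (emeasure (Q \<bind> (\<lambda>p. Pi\<^sub>M I (\<lambda>_. p))))"
    unfolding iid_mixture_def
    by (intro measure_of_eq sets.space_closed) (simp add: sets.sigma_sets_eq emeasure_bind_prob_algebra[OF Q K])
  also have "\<dots> = Q \<bind> (\<lambda>p. Pi\<^sub>M I (\<lambda>_. p))"
    unfolding s[symmetric] sets_eq_imp_space_eq[OF s, symmetric] by (rule measure_of_of_measure)
  finally show ?thesis .
qed

text \<open>The comparison only uses finite subfamilies, so summability over the multi-indices is never needed.\<close>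

lemma infsum_multi_index_le:
  fixes s :: "nat \<Rightarrow> real" and t :: "(nat \<Rightarrow> nat) \<Rightarrow> real"
  assumes sums: "(\<lambda>k. (1 / 2) ^ Suc k * s (Suc k)) sums r"
    and s: "\<And>k. 0 \<le> s k"
    and t: "\<And>k. k \<in> {..<m} \<rightarrow>\<^sub>E {1..} \<Longrightarrow> 0 \<le> t k" "\<And>k. k \<in> {..<m} \<rightarrow>\<^sub>E {1..} \<Longrightarrow> t k \<le> (\<Sum>i<m. s (k i))"
  shows "(\<Sum>\<^sub>\<infinity>k\<in>{..<m} \<rightarrow>\<^sub>E {1..}. 1 / 2 ^ (\<Sum>i<m. k i) * t k) \<le> real m * r"
proof -
  have r: "0 \<le> r" using sums_le[OF _ sums_zero sums] s by simp
  have bound: "(\<Sum>k\<in>F. 1 / 2 ^ (\<Sum>i<m. k i) * t k) \<le> real m * r"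
    if F: "finite F" "F \<subseteq> {..<m} \<rightarrow>\<^sub>E {1..}" for F
  proof -
    \<comment> \<open>A crude bound on all entries of the indices in \<open>F\<close>: it places
      \<open>F\<close> in a finite box, over which the sum factorizes.\<close>
    define K where "K = (\<Sum>k\<in>F. \<Sum>i<m. k i)"
    have kK: "k i \<le> K" if "k \<in> F" "i < m" for k i
    proof -
      have "k i \<le> (\<Sum>i<m. k i)" using that by (intro member_le_sum) auto
      also have "\<dots> \<le> K" unfolding K_def using that F by (intro member_le_sum) auto
      finally show ?thesis .
    qed
    have FK: "F \<subseteq> {..<m} \<rightarrow>\<^sub>E {1..K}"
    proof
      fix k assume k: "k \<in> F"
      with F have "k \<in> {..<m} \<rightarrow>\<^sub>E {1..}" by blast
      then show "k \<in> {..<m} \<rightarrow>\<^sub>E {1..K}" using kK[OF k] by (auto simp: PiE_iff)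
    qed
    \<comment> \<open>The factor of coordinate \<open>j\<close> in the term that carries
      \<open>s\<close> at coordinate \<open>i\<close>. Summed over the box, coordinate
      \<open>i\<close> gives at most \<open>r\<close> and every other one at most 1.\<close>
    define w where "w i j x = (1 / 2) ^ x * (if j = i then s x else 1)" for i j x :: nat
    have fin: "finite ({..<m} \<rightarrow>\<^sub>E {1..K})" by (intro finite_PiE) auto
    have shift: "(\<Sum>x=1..K. (1 / 2) ^ x * v x) = (\<Sum>x<K. (1 / 2) ^ Suc x * v (Suc x))" for v :: "nat \<Rightarrow> real"
      by (rule sum.reindex_bij_witness[where i = Suc and j = "\<lambda>x. x - 1"]) auto
    have half: "0 \<le> (\<Sum>x=1..K. (1 / 2 :: real) ^ x)" "(\<Sum>x=1..K. (1 / 2 :: real) ^ x) \<le> 1"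
    proof -
      show "0 \<le> (\<Sum>x=1..K. (1 / 2 :: real) ^ x)" by (intro sum_nonneg) auto
      have "(\<Sum>x<K. (1 / 2 :: real) ^ Suc x) \<le> (\<Sum>x. (1 / 2) ^ Suc x)"
        by (intro sum_le_suminf sums_summable[OF power_half_series]) auto
      then show "(\<Sum>x=1..K. (1 / 2 :: real) ^ x) \<le> 1"
        using shift[of "\<lambda>_. 1"] sums_unique[OF power_half_series] by simp
    qed
    have sr: "0 \<le> (\<Sum>x=1..K. (1 / 2) ^ x * s x)" "(\<Sum>x=1..K. (1 / 2) ^ x * s x) \<le> r"
    proof -
      show "0 \<le> (\<Sum>x=1..K. (1 / 2) ^ x * s x)" using s by (intro sum_nonneg) auto
      have "(\<Sum>x<K. (1 / 2) ^ Suc x * s (Suc x)) \<le> (\<Sum>x. (1 / 2) ^ Suc x * s (Suc x))"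
        using s by (intro sum_le_suminf sums_summable[OF sums]) auto
      then show "(\<Sum>x=1..K. (1 / 2) ^ x * s x) \<le> r"
        unfolding shift sums_unique[OF sums, symmetric] .
    qed
    have "(\<Sum>k\<in>F. 1 / 2 ^ (\<Sum>i<m. k i) * t k) \<le> (\<Sum>k\<in>F. 1 / 2 ^ (\<Sum>i<m. k i) * (\<Sum>i<m. s (k i)))"
      using F t(2) by (intro sum_mono mult_left_mono) auto
    also have "\<dots> \<le> (\<Sum>k\<in>{..<m} \<rightarrow>\<^sub>E {1..K}. 1 / 2 ^ (\<Sum>i<m. k i) * (\<Sum>i<m. s (k i)))"
      using s by (intro sum_mono2 fin FK mult_nonneg_nonneg sum_nonneg) auto
    also have "\<dots> = (\<Sum>k\<in>{..<m} \<rightarrow>\<^sub>E {1..K}. \<Sum>i<m. \<Prod>j<m. w i j (k j))"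
    proof (rule sum.cong)
      fix k
      have "(\<Prod>j<m. w i j (k j)) = 1 / 2 ^ (\<Sum>i<m. k i) * s (k i)" if "i < m" for i
      proof -
        have "(\<Prod>j<m. (1 / 2 :: real) ^ k j) = 1 / 2 ^ (\<Sum>i<m. k i)"
          by (simp only: power_sum[symmetric] power_one_over[symmetric])
        with that show ?thesis unfolding w_def prod.distrib by simp
      qed
      then show "1 / 2 ^ (\<Sum>i<m. k i) * (\<Sum>i<m. s (k i)) = (\<Sum>i<m. \<Prod>j<m. w i j (k j))"
        by (simp add: sum_distrib_left)
    qed simp
    also have "\<dots> = (\<Sum>i<m. \<Sum>k\<in>{..<m} \<rightarrow>\<^sub>E {1..K}. \<Prod>j<m. w i j (k j))" by (rule sum.swap)
    also have "\<dots> = (\<Sum>i<m. \<Prod>j<m. \<Sum>x=1..K. w i j x)"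
      by (subst prod_sum_PiE) auto
    also have "\<dots> \<le> (\<Sum>i<m. r)"
    proof (rule sum_mono)
      fix i assume i: "i \<in> {..<m}"
      have "(\<Prod>j<m. \<Sum>x=1..K. w i j x) = (\<Sum>x=1..K. w i i x) * (\<Prod>j\<in>{..<m} - {i}. \<Sum>x=1..K. w i j x)"
        using i by (intro prod.remove) auto
      also have "\<dots> \<le> r * 1"
      proof (rule mult_mono)
        show "(\<Sum>x=1..K. w i i x) \<le> r" using sr by (simp add: w_def)
        show "(\<Prod>j\<in>{..<m} - {i}. \<Sum>x=1..K. w i j x) \<le> 1"
          using half by (intro prod_le_1) (auto simp: w_def)
        show "0 \<le> (\<Prod>j\<in>{..<m} - {i}. \<Sum>x=1..K. w i j x)"
          using half by (intro prod_nonneg) (auto simp: w_def)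
      qed (rule r)
      finally show "(\<Prod>j<m. \<Sum>x=1..K. w i j x) \<le> r" by simp
    qed
    finally show ?thesis by simp
  qed
  show ?thesis
  proof (cases "(\<lambda>k. 1 / 2 ^ (\<Sum>i<m. k i) * t k) summable_on ({..<m} \<rightarrow>\<^sub>E {1..})")
    case True
    then show ?thesis by (rule infsum_le_finite_sums) (rule bound)
  next
    \<comment> \<open>\<open>infsum\<close> of a family that is not summable is 0.\<close>
    case False
    then show ?thesis using r by (simp add: infsum_not_exists)
  qed
qed

text \<open>Up to a tail of at most \<open>2\<^sup>-\<^sup>K\<close> the weak distance to
  \<open>\<mu>\<close> is bounded by a finite sum of weakly continuous functionals, so each of its
  balls contains a weak neighbourhood of the centre. This makes the test functions of the second
  level measurable.\<close>

lemma weak_dist_lipschitz_continuous_map: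
  fixes T :: "'a topology" and D :: "'a \<Rightarrow> 'a \<Rightarrow> real" and g :: "nat \<Rightarrow> 'a \<Rightarrow> real"
  defines "b \<equiv> \<lambda>k. BL_normalize (topspace T) D (g (Suc k))"
  assumes b: "\<And>k. continuous_map T euclideanreal (b k)" "\<And>k x. x \<in> topspace T \<Longrightarrow> b k x \<in> {0..1}"
    and h: "lipschitz_wrt (topspace (weak_topology T)) (weak_dist T D g) h"
  shows "continuous_map (weak_topology T) euclideanreal h"
proof -
  let ?P = "space (prob_algebra (borel_of T))"
  have bint: "(\<integral>x. b k x \<partial>\<mu>) \<in> {0..1}" if "\<mu> \<in> ?P" for \<mu> k
    using that b(2) measurable_cong_sets[of \<mu> "borel_of T" borel borel] continuous_map_borel_of[OF b(1)]
    by (intro integral_in_unit_interval) (auto simp: space_prob_algebra dest: sets_eq_imp_space_eq)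
  obtain L where L: "\<And>x y. x \<in> ?P \<Longrightarrow> y \<in> ?P \<Longrightarrow> \<bar>h x - h y\<bar> \<le> L * weak_dist T D g x y"
    using h unfolding lipschitz_wrt_def topspace_weak_topology by blast
  show ?thesis
    unfolding continuous_map_def
  proof (intro conjI allI impI)
    fix U :: "real set" assume "openin euclideanreal U"
    then have U: "open U" by simp
    show "openin (weak_topology T) {\<mu> \<in> topspace (weak_topology T). h \<mu> \<in> U}"
    proof (subst openin_subopen, intro ballI)
      fix \<mu> assume "\<mu> \<in> {\<mu> \<in> topspace (weak_topology T). h \<mu> \<in> U}"
      then have \<mu>: "\<mu> \<in> ?P" "h \<mu> \<in> U" by auto
      then obtain e where e: "e > 0" "\<And>y. \<bar>y - h \<mu>\<bar> < e \<Longrightarrow> y \<in> U"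
        using U by (auto simp: open_dist dist_real_def)
      define \<delta> where "\<delta> = e / (\<bar>L\<bar> + 1)"
      have "\<delta> > 0" using e by (simp add: \<delta>_def)
      obtain K where K: "(1 / 2 :: real) ^ K < \<delta> / 2"
        using real_arch_pow_inv[of "\<delta> / 2" "1 / 2"] \<open>\<delta> > 0\<close> by auto
      define \<phi> where "\<phi> \<nu> = (\<Sum>k<K. \<bar>(\<integral>x. b k x \<partial>\<nu>) - (\<integral>x. b k x \<partial>\<mu>)\<bar>)" for \<nu>
      have bb: "bounded (b k ` topspace T)" for k
        using b(2) unfolding bounded_iff by (intro exI[of _ 1]) auto
      have "continuous_map (weak_topology T) euclideanreal \<phi>"
        unfolding \<phi>_def by (intro continuous_intros continuous_map_integral b(1) bb) auto
      from openin_continuous_map_preimage[OF this, of "{..<\<delta> / 2}"]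
      have op: "openin (weak_topology T) {\<nu> \<in> ?P. \<phi> \<nu> < \<delta> / 2}" by simp
      have sub: "h \<nu> \<in> U" if \<nu>: "\<nu> \<in> ?P" "\<phi> \<nu> < \<delta> / 2" for \<nu>
      proof -
        define a where "a k = \<bar>(\<integral>x. b k x \<partial>\<nu>) - (\<integral>x. b k x \<partial>\<mu>)\<bar>" for k
        have a1: "0 \<le> a k" "a k \<le> 1" for k
          using bint[OF \<nu>(1), of k] bint[OF \<mu>(1), of k] by (auto simp: a_def)
        have sums: "(\<lambda>k. (1 / 2) ^ Suc k * a k) sums weak_dist T D g \<nu> \<mu>"
          using weak_dist_sums[where T = T and D = D and g = g and \<mu> = \<nu> and \<nu> = \<mu> and C = 1] a1 unfolding a_def b_def by simp
        have tail: "(\<lambda>k. (1 / 2) ^ K * (1 / 2 :: real) ^ Suc k) sums ((1 / 2) ^ K * 1)"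
          by (intro sums_mult power_half_series)
        have init: "(\<lambda>k. (1 / 2) ^ Suc (k + K) * a (k + K)) sums (weak_dist T D g \<nu> \<mu> - (\<Sum>k<K. (1 / 2) ^ Suc k * a k))"
          by (rule sums_split_initial_segment[OF sums])
        have "weak_dist T D g \<nu> \<mu> - (\<Sum>k<K. (1 / 2) ^ Suc k * a k) \<le> (1 / 2) ^ K * 1"
          by (rule sums_le[OF _ init tail]) (use a1 in \<open>auto simp: power_add mult_left_le\<close>)
        moreover have "(\<Sum>k<K. (1 / 2) ^ Suc k * a k) \<le> \<phi> \<nu>"
          unfolding \<phi>_def a_def[symmetric] using a1
          by (intro sum_mono mult_left_le_one_le power_le_one) auto
        ultimately have lt: "weak_dist T D g \<nu> \<mu> < \<delta>" using K \<nu>(2) by simp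
        have "\<bar>h \<nu> - h \<mu>\<bar> \<le> L * weak_dist T D g \<nu> \<mu>" using L \<nu>(1) \<mu>(1) by blast
        also have "\<dots> \<le> (\<bar>L\<bar> + 1) * weak_dist T D g \<nu> \<mu>"
          by (intro mult_right_mono weak_dist_nonneg) auto
        also have "\<dots> < e" using lt by (simp add: \<delta>_def field_simps)
        finally show ?thesis by (rule e(2))
      qed
      show "\<exists>V. openin (weak_topology T) V \<and> \<mu> \<in> V \<and> V \<subseteq> {\<mu> \<in> topspace (weak_topology T). h \<mu> \<in> U}"
        using op sub \<mu>(1) \<open>\<delta> > 0\<close>
        by (intro exI[of _ "{\<nu> \<in> ?P. \<phi> \<nu> < \<delta> / 2}"]) (auto simp: \<phi>_def)
    qed
  qed simp
qed

section \<open>Comparison of both distances with the radius\<close>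

lemma integral_continuous_map:
  fixes c :: "'a \<Rightarrow> real"
  assumes c: "continuous_map T euclideanreal c" "\<And>x. x \<in> topspace T \<Longrightarrow> c x \<in> {0..1}"
  shows integral_range_prob_algebra: "p \<in> space (prob_algebra (borel_of T)) \<Longrightarrow> (\<integral>x. c x \<partial>p) \<in> {0..1}"
    and integrable_prob_algebra: "p \<in> space (prob_algebra (borel_of T)) \<Longrightarrow> integrable p c"
    and integral_measurable_weak: "(\<lambda>p. \<integral>x. c x \<partial>p) \<in> borel_measurable (borel_of (weak_topology T))"
proof -
  have m: "c \<in> borel_measurable (borel_of T)" using c(1) by (rule continuous_map_borel_of)
  show "(\<integral>x. c x \<partial>p) \<in> {0..1}" "integrable p c" if p: "p \<in> space (prob_algebra (borel_of T))"
  proof -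
    have sp: "sets p = sets (borel_of T)" "prob_space p" using p by (auto simp: space_prob_algebra)
    have r: "c x \<in> {0..1}" if "x \<in> space p" for x
      using that c(2) sets_eq_imp_space_eq[OF sp(1)] by simp
    have "c \<in> borel_measurable p" using m measurable_cong_sets[OF sp(1) refl] by blast
    from integral_in_unit_interval[OF sp(2) this r] show "(\<integral>x. c x \<partial>p) \<in> {0..1}" "integrable p c"
      by auto
  qed
  have "bounded (c ` topspace T)" using c(2) unfolding bounded_iff by (intro exI[of _ 1]) auto
  with c(1) show "(\<lambda>p. \<integral>x. c x \<partial>p) \<in> borel_measurable (borel_of (weak_topology T))"
    by (intro continuous_map_borel_of continuous_map_integral)
qed

text \<open>Integration against the point mass is evaluation at \<open>e\<close>, so each
  1-Lipschitz test function differs by at most the mean weak distance to \<open>e\<close> under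
  \<open>Q\<close>. Exchanging series and integral identifies this mean with \<open>r\<close>, and
  the weights sum to 1.\<close>

lemma weak_dist_return_le:
  fixes T :: "'a topology" and D :: "'a \<Rightarrow> 'a \<Rightarrow> real" and g :: "nat \<Rightarrow> 'a \<Rightarrow> real"
    and h :: "nat \<Rightarrow> 'a measure \<Rightarrow> real"
  defines "b \<equiv> \<lambda>k. BL_normalize (topspace T) D (g (Suc k))"
  assumes b: "\<And>k. continuous_map T euclideanreal (b k)" "\<And>k x. x \<in> topspace T \<Longrightarrow> b k x \<in> {0..1}"
    and h: "\<And>k. h (Suc k) \<in> topspace (weak_topology T) \<rightarrow> {0..1}"
      "\<And>k. lipschitz_wrt (topspace (weak_topology T)) (weak_dist T D g) (h (Suc k))"
    and Q: "Q \<in> space (prob_algebra (borel_of (weak_topology T)))"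
    and e: "e \<in> space (prob_algebra (borel_of T))"
    and r: "(\<lambda>k. (1 / 2) ^ Suc k * (\<integral>p. \<bar>(\<integral>x. b k x \<partial>p) - (\<integral>x. b k x \<partial>e)\<bar> \<partial>Q)) sums r"
  shows "weak_dist (weak_topology T) (weak_dist T D g) h Q (return (borel_of (weak_topology T)) e) \<le> r"
proof -
  let ?P = "space (prob_algebra (borel_of T))" and ?N = "borel_of (weak_topology T)" and ?wd = "weak_dist T D g"
  define H where "H k = BL_normalize (topspace (weak_topology T)) ?wd (h (Suc k))" for k
  define a where "a k p = \<bar>(\<integral>x. b k x \<partial>p) - (\<integral>x. b k x \<partial>e)\<bar>" for k p
  have sQ: "sets Q = sets ?N" "prob_space Q" using Q by (auto simp: space_prob_algebra)
  interpret Q: prob_space Q by (rule sQ)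
  have spQ: "space Q = ?P" using sets_eq_imp_space_eq[OF sQ(1)] by simp
  have Hcont: "continuous_map (weak_topology T) euclideanreal (H k)" for k
    unfolding H_def using weak_dist_lipschitz_continuous_map[of T D g, OF b[unfolded b_def] h(2)]
    by (intro BL_normalize_continuous_map)
  have Hrange: "H k p \<in> {0..1}" if "p \<in> ?P" for k p
    unfolding H_def using that by (intro BL_normalize_range h weak_dist_nonneg) auto
  have Hlip: "\<bar>H k p - H k p'\<bar> \<le> ?wd p p'" if "p \<in> ?P" "p' \<in> ?P" for k p p'
    unfolding H_def using that by (intro BL_normalize_lipschitz h weak_dist_nonneg) auto
  have HN: "H k \<in> borel_measurable ?N" for k using Hcont by (rule continuous_map_borel_of)
  have Hint: "integrable Q (H k)" for k
    using integrable_prob_algebra[OF Hcont, of k Q] Hrange Q by auto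
  have a1: "0 \<le> a k p" "a k p \<le> 1" if "p \<in> ?P" for k p
    using integral_range_prob_algebra[OF b that, of k] integral_range_prob_algebra[OF b e, of k] by (auto simp: a_def)
  have aQ: "a k \<in> borel_measurable Q" for k
    using integral_measurable_weak[OF b, of k] measurable_cong_sets[OF sQ(1) refl]
    unfolding a_def by (intro borel_measurable_abs borel_measurable_diff borel_measurable_const) auto
  have aint: "integrable Q (a k)" for k
    using aQ a1 spQ by (intro Q.integrable_const_bound[where B = 1]) auto
  have wd: "(\<lambda>k. (1 / 2) ^ Suc k * a k p) sums ?wd p e" if "p \<in> ?P" for p
    using weak_dist_sums[where T = T and D = D and g = g and \<mu> = p and \<nu> = e and C = 1] a1[OF that]
    unfolding a_def b_def by simp
  have sr: "(\<lambda>k. (1 / 2) ^ Suc k * (\<integral>p. a k p \<partial>Q)) sums r" using r unfolding a_def .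
  have norm_a: "(\<integral>p. norm ((1 / 2) ^ Suc k * a k p) \<partial>Q) = (1 / 2) ^ Suc k * (\<integral>p. a k p \<partial>Q)" for k
  proof -
    have "(\<integral>p. norm ((1 / 2) ^ Suc k * a k p) \<partial>Q) = (\<integral>p. (1 / 2) ^ Suc k * a k p \<partial>Q)"
      using a1 spQ by (intro Bochner_Integration.integral_cong) (auto simp: abs_mult)
    then show ?thesis by simp
  qed
  have 1: "AE p in Q. summable (\<lambda>k. norm ((1 / 2) ^ Suc k * a k p))"
  proof (rule AE_I2)
    fix p assume "p \<in> space Q"
    then have p: "p \<in> ?P" by (simp add: spQ)
    show "summable (\<lambda>k. norm ((1 / 2) ^ Suc k * a k p))"
      using sums_summable[OF wd[OF p]] a1[OF p] by (simp add: abs_mult)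
  qed
  have 2: "summable (\<lambda>k. \<integral>p. norm ((1 / 2) ^ Suc k * a k p) \<partial>Q)"
    unfolding norm_a using sr by (rule sums_summable)
  have ai: "integrable Q (\<lambda>p. (1 / 2) ^ Suc k * a k p)" for k using aint by simp
  have wd_eq: "(\<Sum>k. (1 / 2) ^ Suc k * a k p) = ?wd p e" if "p \<in> space Q" for p
    using wd[of p] that spQ by (simp add: sums_iff)
  \<comment> \<open>The series representation also yields the measurability of the distance in
    \<open>p\<close>.\<close>
  have wd_int: "integrable Q (\<lambda>p. ?wd p e)"
    using integrable_suminf[OF ai 1 2] by (simp only: Bochner_Integration.integrable_cong[OF refl wd_eq])
  have "(\<integral>p. ?wd p e \<partial>Q) = (\<integral>p. (\<Sum>k. (1 / 2) ^ Suc k * a k p) \<partial>Q)"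
    by (rule Bochner_Integration.integral_cong[OF refl wd_eq, symmetric])
  also have "\<dots> = (\<Sum>k. \<integral>p. (1 / 2) ^ Suc k * a k p \<partial>Q)" by (rule integral_suminf[OF ai 1 2])
  also have "\<dots> = r" using sr by (simp add: sums_iff)
  finally have wd_r: "(\<integral>p. ?wd p e \<partial>Q) = r" .
  have close: "\<bar>(\<integral>p. H k p \<partial>Q) - (\<integral>p. H k p \<partial>return ?N e)\<bar> \<le> r" for k
  proof -
    have "(\<integral>p. H k p \<partial>return ?N e) = H k e"
      using e HN by (intro integral_return) auto
    then have "(\<integral>p. H k p \<partial>Q) - (\<integral>p. H k p \<partial>return ?N e) = (\<integral>p. H k p - H k e \<partial>Q)"
      using Hint by (simp add: Q.prob_space)
    also have "\<bar>\<dots>\<bar> \<le> (\<integral>p. \<bar>H k p - H k e\<bar> \<partial>Q)" by (rule integral_abs_bound)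
    also have "\<dots> \<le> (\<integral>p. ?wd p e \<partial>Q)"
      using Hint wd_int e by (intro integral_mono) (auto simp: spQ intro!: Hlip)
    finally show ?thesis unfolding wd_r .
  qed
  have s1: "(\<lambda>k. (1 / 2) ^ Suc k * \<bar>(\<integral>p. H k p \<partial>Q) - (\<integral>p. H k p \<partial>return ?N e)\<bar>)
      sums weak_dist (weak_topology T) ?wd h Q (return ?N e)"
    using weak_dist_sums[where T = "weak_topology T" and D = ?wd and g = h and \<mu> = Q and \<nu> = "return ?N e" and C = r] close
    unfolding H_def by simp
  have s2: "(\<lambda>k. (1 / 2 :: real) ^ Suc k * r) sums (1 * r)"
    by (intro sums_mult2 power_half_series)
  have "weak_dist (weak_topology T) ?wd h Q (return ?N e) \<le> 1 * r"
    by (rule sums_le[OF _ s1 s2]) (intro mult_left_mono close; simp)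
  then show ?thesis by simp
qed

text \<open>Given \<open>p\<close>, a product test function integrates to a product of means in the
  unit interval; replacing the factors one at a time changes it by at most the sum of the single
  differences. Each of the \<open>m\<close> coordinates then contributes at most
  \<open>r\<close>.\<close>

lemma weak_dist_power_le:
  fixes X :: "'a::metric_space set" and D :: "'a \<Rightarrow> 'a \<Rightarrow> real" and g :: "nat \<Rightarrow> 'a \<Rightarrow> real"
  defines "b \<equiv> \<lambda>k. BL_normalize (topspace (top_of_set X)) D (g k)"
  assumes b: "\<And>k. k \<ge> 1 \<Longrightarrow> continuous_map (top_of_set X) euclideanreal (b k)" "\<And>k x. k \<ge> 1 \<Longrightarrow> x \<in> X \<Longrightarrow> b k x \<in> {0..1}"
    and Q: "Q \<in> space (prob_algebra (borel_of (weak_topology (top_of_set X))))"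
    and e: "e \<in> space (prob_algebra (borel_of (top_of_set X)))"
    and r: "(\<lambda>k. (1 / 2) ^ Suc k * (\<integral>p. \<bar>(\<integral>x. b (Suc k) x \<partial>p) - (\<integral>x. b (Suc k) x \<partial>e)\<bar> \<partial>Q)) sums r"
  shows "weak_dist_power (top_of_set X) D g m (iid_mixture (top_of_set X) {..<m} Q) (Pi\<^sub>M {..<m} (\<lambda>_. e)) \<le> real m * r"
proof -
  let ?M = "borel_of (top_of_set X)" and ?N = "borel_of (weak_topology (top_of_set X))"
  let ?P = "space (prob_algebra ?M)" and ?MM = "Pi\<^sub>M {..<m} (\<lambda>_. borel_of (top_of_set X))"
  have bX: "x \<in> topspace (top_of_set X) \<Longrightarrow> b k x \<in> {0..1}" if "k \<ge> 1" for k x using b(2)[OF that] by simp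
  have sQ: "sets Q = sets ?N" "prob_space Q" using Q by (auto simp: space_prob_algebra)
  interpret Q: prob_space Q by (rule sQ)
  have spQ: "space Q = ?P" using sets_eq_imp_space_eq[OF sQ(1)] by simp
  define \<mu> where "\<mu> k p = (\<integral>x. b k x \<partial>p)" for k p
  define s where "s k = (\<integral>p. \<bar>\<mu> k p - \<mu> k e\<bar> \<partial>Q)" for k
  have \<mu>01: "\<mu> k p \<in> {0..1}" if "k \<ge> 1" "p \<in> ?P" for k p
    unfolding \<mu>_def using integral_range_prob_algebra[OF b(1) bX] that by auto
  have \<mu>Q: "\<mu> k \<in> borel_measurable Q" if "k \<ge> 1" for k
    using integral_measurable_weak[OF b(1) bX] that measurable_cong_sets[OF sQ(1) refl] unfolding \<mu>_def by auto
  have K: "(\<lambda>p. Pi\<^sub>M {..<m} (\<lambda>_. p)) \<in> Q \<rightarrow>\<^sub>M subprob_algebra ?MM"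
    using measurable_prob_algebraD[OF measurable_compose[OF id_measurable_weak_topology measurable_PiM_power]]
      measurable_cong_sets[OF sQ(1) refl] by blast
  have prod_int: "(\<integral>x. (\<Prod>i<m. b (k i) (x i)) \<partial>Pi\<^sub>M {..<m} (\<lambda>_. p)) = (\<Prod>i<m. \<mu> (k i) p)"
    "integrable (Pi\<^sub>M {..<m} (\<lambda>_. p)) (\<lambda>x. \<Prod>i<m. b (k i) (x i))"
    if p: "p \<in> ?P" and k: "k \<in> {..<m} \<rightarrow>\<^sub>E {1..}" for p and k :: "nat \<Rightarrow> nat"
  proof -
    interpret p: prob_space p using p by (simp add: space_prob_algebra)
    interpret pp: product_sigma_finite "\<lambda>_::nat. p" by standard
    have "integrable p (b (k i))" if "i \<in> {..<m}" for i
      using integrable_prob_algebra[OF b(1) bX p] k that by (auto simp: PiE_iff)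
    then show "(\<integral>x. (\<Prod>i<m. b (k i) (x i)) \<partial>Pi\<^sub>M {..<m} (\<lambda>_. p)) = (\<Prod>i<m. \<mu> (k i) p)"
      "integrable (Pi\<^sub>M {..<m} (\<lambda>_. p)) (\<lambda>x. \<Prod>i<m. b (k i) (x i))"
      unfolding \<mu>_def by (intro pp.product_integral_prod pp.product_integrable_prod; simp)+
  qed
  have mix: "(\<integral>x. (\<Prod>i<m. b (k i) (x i)) \<partial>iid_mixture (top_of_set X) {..<m} Q) = (\<integral>p. (\<Prod>i<m. \<mu> (k i) p) \<partial>Q)"
    if k: "k \<in> {..<m} \<rightarrow>\<^sub>E {1..}" for k :: "nat \<Rightarrow> nat"
  proof -
    let ?F = "\<lambda>x. \<Prod>i<m. b (k i) (x i)"
    have k1: "k i \<ge> 1" if "i < m" for i using k that by (auto simp: PiE_iff)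
    have "(\<lambda>x. b (k i) (x i)) \<in> borel_measurable ?MM" if i: "i \<in> {..<m}" for i
      using i by (intro measurable_compose[OF measurable_component_singleton[OF i, of "\<lambda>_. ?M"]]
          continuous_map_borel_of b(1) k1) auto
    then have F: "?F \<in> borel_measurable ?MM" by (rule borel_measurable_prod)
    have sets_mix: "sets (Q \<bind> (\<lambda>p. Pi\<^sub>M {..<m} (\<lambda>_. p))) = sets ?MM"
      using K Q.not_empty by (rule sets_bind_measurable)
    have F0: "0 \<le> ?F x" if "x \<in> space ?MM" for x
    proof (rule prod_nonneg)
      fix i assume "i \<in> {..<m}"
      then show "0 \<le> b (k i) (x i)" using b(2)[OF k1, of i "x i"] that by (auto simp: space_PiM PiE_iff)
    qed
    \<comment> \<open>The integrand is nonnegative on the product space, which allows the detour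
      through \<open>nn_integral_bind\<close>.\<close>
    have "(\<integral>x. ?F x \<partial>(Q \<bind> (\<lambda>p. Pi\<^sub>M {..<m} (\<lambda>_. p)))) = enn2real (\<integral>\<^sup>+x. ennreal (?F x) \<partial>(Q \<bind> (\<lambda>p. Pi\<^sub>M {..<m} (\<lambda>_. p))))"
    proof (rule integral_eq_nn_integral)
      show "?F \<in> borel_measurable (Q \<bind> (\<lambda>p. Pi\<^sub>M {..<m} (\<lambda>_. p)))"
        using F measurable_cong_sets[OF sets_mix refl] by blast
      show "AE x in Q \<bind> (\<lambda>p. Pi\<^sub>M {..<m} (\<lambda>_. p)). 0 \<le> ?F x"
        using F0 sets_eq_imp_space_eq[OF sets_mix] by (intro AE_I2) auto
    qed
    also have "(\<integral>\<^sup>+x. ennreal (?F x) \<partial>(Q \<bind> (\<lambda>p. Pi\<^sub>M {..<m} (\<lambda>_. p)))) = (\<integral>\<^sup>+p. \<integral>\<^sup>+x. ennreal (?F x) \<partial>Pi\<^sub>M {..<m} (\<lambda>_. p) \<partial>Q)"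
      using F by (intro nn_integral_bind[OF _ K]) simp
    also have "\<dots> = (\<integral>\<^sup>+p. ennreal (\<Prod>i<m. \<mu> (k i) p) \<partial>Q)"
    proof (rule nn_integral_cong)
      fix p assume "p \<in> space Q"
      then have p: "p \<in> ?P" by (simp add: spQ)
      have sp: "sets (Pi\<^sub>M {..<m} (\<lambda>_. p)) = sets ?MM"
        using p by (intro sets_PiM_cong) (auto simp: space_prob_algebra)
      show "(\<integral>\<^sup>+x. ennreal (?F x) \<partial>Pi\<^sub>M {..<m} (\<lambda>_. p)) = ennreal (\<Prod>i<m. \<mu> (k i) p)"
        using prod_int[OF p k] F0 sets_eq_imp_space_eq[OF sp] by (subst nn_integral_eq_integral) auto
    qed
    also have "enn2real \<dots> = (\<integral>p. (\<Prod>i<m. \<mu> (k i) p) \<partial>Q)"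
      using \<mu>Q k1 \<mu>01 spQ
      by (intro integral_eq_nn_integral[symmetric] borel_measurable_prod AE_I2 prod_nonneg) auto
    finally show ?thesis unfolding iid_mixture_eq_bind[OF Q] .
  qed
  have "weak_dist_power (top_of_set X) D g m (iid_mixture (top_of_set X) {..<m} Q) (Pi\<^sub>M {..<m} (\<lambda>_. e))
    = (\<Sum>\<^sub>\<infinity>k\<in>{..<m} \<rightarrow>\<^sub>E {1..}. 1 / 2 ^ (\<Sum>i<m. k i) *
        \<bar>(\<integral>x. (\<Prod>i<m. b (k i) (x i)) \<partial>iid_mixture (top_of_set X) {..<m} Q) - (\<integral>x. (\<Prod>i<m. b (k i) (x i)) \<partial>Pi\<^sub>M {..<m} (\<lambda>_. e))\<bar>)"
    unfolding weak_dist_power_def b_def ..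
  also have "\<dots> \<le> real m * r"
  proof (rule infsum_multi_index_le[where s = s])
    show "(\<lambda>k. (1 / 2) ^ Suc k * s (Suc k)) sums r" using r unfolding s_def \<mu>_def .
    show "0 \<le> s k" for k unfolding s_def by simp
    fix k :: "nat \<Rightarrow> nat" assume k: "k \<in> {..<m} \<rightarrow>\<^sub>E {1..}"
    have k1: "k i \<ge> 1" if "i < m" for i using k that by (auto simp: PiE_iff)
    have pm: "integrable Q (\<lambda>p. \<Prod>i<m. \<mu> (k i) p)"
    proof (rule Q.integrable_const_bound[where B = 1])
      show "AE p in Q. norm (\<Prod>i<m. \<mu> (k i) p) \<le> 1"
        using \<mu>01[OF k1] spQ by (intro AE_I2) (auto simp: abs_prod intro!: prod_le_1)
    qed (use \<mu>Q k1 in \<open>auto intro!: borel_measurable_prod\<close>)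
    have di: "integrable Q (\<lambda>p. \<bar>\<mu> (k i) p - \<mu> (k i) e\<bar>)" if i: "i \<in> {..<m}" for i
    proof -
      have "integrable Q (\<mu> (k i))"
        using i \<mu>01[OF k1] spQ \<mu>Q[OF k1] by (intro Q.integrable_const_bound[where B = 1] AE_I2) auto
      then show ?thesis by simp
    qed
    have "\<bar>(\<integral>p. (\<Prod>i<m. \<mu> (k i) p) \<partial>Q) - (\<Prod>i<m. \<mu> (k i) e)\<bar> = \<bar>\<integral>p. (\<Prod>i<m. \<mu> (k i) p) - (\<Prod>i<m. \<mu> (k i) e) \<partial>Q\<bar>"
      using pm by (simp add: Q.prob_space)
    also have "\<dots> \<le> (\<integral>p. \<bar>(\<Prod>i<m. \<mu> (k i) p) - (\<Prod>i<m. \<mu> (k i) e)\<bar> \<partial>Q)" by (rule integral_abs_bound)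
    also have "\<dots> \<le> (\<integral>p. (\<Sum>i<m. \<bar>\<mu> (k i) p - \<mu> (k i) e\<bar>) \<partial>Q)"
    proof (rule integral_mono)
      fix p assume "p \<in> space Q"
      then have p: "p \<in> ?P" by (simp add: spQ)
      show "\<bar>(\<Prod>i<m. \<mu> (k i) p) - (\<Prod>i<m. \<mu> (k i) e)\<bar> \<le> (\<Sum>i<m. \<bar>\<mu> (k i) p - \<mu> (k i) e\<bar>)"
        using norm_prod_diff[of "{..<m}" "\<lambda>i. \<mu> (k i) p" "\<lambda>i. \<mu> (k i) e"] \<mu>01[OF k1 p] \<mu>01[OF k1 e] by auto
    qed (use pm di in auto)
    also have "\<dots> = (\<Sum>i<m. s (k i))"
      unfolding s_def using di by (rule Bochner_Integration.integral_sum)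
    finally show "\<bar>(\<integral>x. (\<Prod>i<m. b (k i) (x i)) \<partial>iid_mixture (top_of_set X) {..<m} Q)
        - (\<integral>x. (\<Prod>i<m. b (k i) (x i)) \<partial>Pi\<^sub>M {..<m} (\<lambda>_. e))\<bar> \<le> (\<Sum>i<m. s (k i))"
      unfolding mix[OF k] prod_int(1)[OF e k] .
  qed simp
  finally show ?thesis .
qed

theorem theorem3:
  fixes X :: "'a::polish_space set"
    and d :: "'a \<Rightarrow> 'a \<Rightarrow> real"
    and g :: "nat \<Rightarrow> 'a \<Rightarrow> real"
    and h :: "nat \<Rightarrow> 'a measure \<Rightarrow> real"
    and q :: "'a measure measure"
    and \<rho> :: "(nat \<Rightarrow> 'a) measure"
    and ptilde :: "(nat \<Rightarrow> 'a) \<Rightarrow> 'a measure"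
    and post :: "nat \<Rightarrow> (nat \<Rightarrow> 'a) \<Rightarrow> 'a measure measure"
  assumes X: "X \<in> sets borel"
    and d: "Metric_space X d"
    and d_topology: "Metric_space.mtopology X d = top_of_set X"
    and d_totally_bounded: "Metric_space.mtotally_bounded X d X"
    and g: "admissible_family (top_of_set X) d g"
    and h: "admissible_family (weak_topology (top_of_set X)) (weak_dist (top_of_set X) d g) h"
    and q: "q \<in> space (prob_algebra (borel_of (weak_topology (top_of_set X))))"
    and rho: "\<rho> = iid_mixture (top_of_set X) UNIV q"
    and ptilde_measurable: "ptilde \<in> \<rho> \<rightarrow>\<^sub>M borel_of (weak_topology (top_of_set X))"
    and ptilde_distr: "distr \<rho> (borel_of (weak_topology (top_of_set X))) ptilde = q"
    and ptilde_limit: "AE \<omega> in \<rho>. limitin (weak_topology (top_of_set X))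
          (\<lambda>n. empirical_measure (top_of_set X) n \<omega>) (ptilde \<omega>) sequentially"
    and post: "\<And>n. n \<ge> 1 \<Longrightarrow> regular_conditional_distribution \<rho>
          (Pi\<^sub>M {..<n} (\<lambda>_. borel_of (top_of_set X))) (\<lambda>\<omega>. restrict \<omega> {..<n})
          (borel_of (weak_topology (top_of_set X))) ptilde (post n)"
  shows "(AE \<omega> in \<rho>. limsup (\<lambda>n. ereal (sqrt (real n / ln (ln (real n))) *
            weak_dist (weak_topology (top_of_set X)) (weak_dist (top_of_set X) d g) h
              (post n (restrict \<omega> {..<n}))
              (return (borel_of (weak_topology (top_of_set X)))
                (empirical_measure (top_of_set X) n \<omega>))))
          \<le> ereal (sqrt 2)) \<and>
        (\<forall>m\<ge>1. AE \<omega> in \<rho>. limsup (\<lambda>n. ereal (sqrt (real n / ln (ln (real n))) *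
            weak_dist_power (top_of_set X) d g m
              (iid_mixture (top_of_set X) {..<m} (post n (restrict \<omega> {..<n})))
              (Pi\<^sub>M {..<m} (\<lambda>_. empirical_measure (top_of_set X) n \<omega>))))
          \<le> ereal (sqrt 2 * real m))"
proof -
  let ?T = "top_of_set X"
  let ?W = "weak_topology ?T"
  let ?wd = "weak_dist ?T d g"
  define f where "f k = BL_normalize X d (g k)" for k
  have gk: "g k \<in> X \<rightarrow> {0..1}" "lipschitz_wrt X d (g k)" if "k \<ge> 1" for k
    using g that by (auto simp: admissible_family_def)
  have hk: "h (Suc k) \<in> topspace ?W \<rightarrow> {0..1}" "lipschitz_wrt (topspace ?W) ?wd (h (Suc k))" for k
    using h by (simp_all add: admissible_family_def)
  have f_cont: "continuous_map ?T euclideanreal (f k)" if "k \<ge> 1" for k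
    unfolding f_def
    by (intro BL_normalize_continuous_map lipschitz_wrt_continuous_map[OF d d_topology] gk that)
  have f_unit: "f k x \<in> {0..1}" if "k \<ge> 1" "x \<in> X" for k x
    unfolding f_def using that gk Metric_space.nonneg[OF d] by (intro BL_normalize_range)
  have f_bounded: "bounded (f k ` topspace ?T)" if "k \<ge> 1" for k
    using f_unit[OF that] unfolding bounded_iff by (intro exI[of _ 1]) auto
  have f_meas: "f k \<in> borel_measurable (borel_of ?T)" if "k \<ge> 1" for k
    using f_cont[OF that] by (rule continuous_map_borel_of)
  have rho_bind: "\<rho> = q \<bind> (\<lambda>p. Pi\<^sub>M UNIV (\<lambda>_. p))"
    unfolding rho by (rule iid_mixture_eq_bind[OF q])
  have sample: "\<omega> i \<in> X" if "\<omega> \<in> space \<rho>" for \<omega> i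
    using that unfolding rho iid_mixture_def by (auto simp: space_measure_of_conv space_PiM)
  have "AE \<omega> in \<rho>. \<forall>k. (\<lambda>n. (\<Sum>i<n. f (Suc k) (\<omega> i)) / real n) \<longlonglongrightarrow> (\<integral>x. f (Suc k) x \<partial>ptilde \<omega>)"
    using ptilde_limit AE_space
  proof eventually_elim
    case (elim \<omega>)
    show ?case
    proof
      fix k
      have "(\<lambda>n. \<integral>x. f (Suc k) x \<partial>empirical_measure ?T n \<omega>) \<longlonglongrightarrow> (\<integral>x. f (Suc k) x \<partial>ptilde \<omega>)"
        by (rule limitin_weak_topology_integral[OF elim(1) f_cont f_bounded]) simp_all
      \<comment> \<open>The average formula is available from \<open>n = 1\<close> on, which
        suffices for a limit.\<close>
      moreover have "eventually (\<lambda>n. (\<integral>x. f (Suc k) x \<partial>empirical_measure ?T n \<omega>) = (\<Sum>i<n. f (Suc k) (\<omega> i)) / real n) sequentially"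
        using eventually_ge_at_top[of 1]
        by eventually_elim (intro integral_empirical_measure f_meas, auto simp: sample[OF elim(2)])
      ultimately show "(\<lambda>n. (\<Sum>i<n. f (Suc k) (\<omega> i)) / real n) \<longlonglongrightarrow> (\<integral>x. f (Suc k) x \<partial>ptilde \<omega>)"
        using tendsto_cong by fast
    qed
  qed
  \<comment> \<open>The given family starts at \<open>k = 1\<close>, that of the locale at 0, hence
    \<open>f (Suc k)\<close>.\<close>
  then interpret mixture_posterior "borel_of ?T" "borel_of ?W" q \<rho> ptilde post "\<lambda>k. f (Suc k)"
    by unfold_locales
      (use id_measurable_weak_topology q rho_bind ptilde_measurable post f_meas f_unit in auto)
  have bounds: "weak_dist ?W ?wd h (post n (restrict \<omega> {..<n})) (return (borel_of ?W) (empirical_measure ?T n \<omega>))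
      \<le> radius n (restrict \<omega> {..<n})" (is ?A)
    "weak_dist_power ?T d g m (iid_mixture ?T {..<m} (post n (restrict \<omega> {..<n}))) (Pi\<^sub>M {..<m} (\<lambda>_. empirical_measure ?T n \<omega>))
      \<le> real m * radius n (restrict \<omega> {..<n})" (is ?B)
    if n: "n \<ge> 1" and \<omega>: "\<omega> \<in> space \<rho>" for n m \<omega>
  proof -
    let ?x = "restrict \<omega> {..<n}" and ?e = "empirical_measure ?T n \<omega>"
    have \<omega>X: "\<omega> i \<in> topspace ?T" for i using sample[OF \<omega>] by simp
    have x: "?x \<in> space (Pi\<^sub>M {..<n} (\<lambda>_. borel_of ?T))"
      using measurable_space[OF restrict_rho \<omega>] .
    have Q: "post n ?x \<in> space (prob_algebra (borel_of ?W))"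
      using measurable_space[OF post_measurable[OF n] x] .
    have e: "?e \<in> space (prob_algebra (borel_of ?T))"
      using \<omega>X n by (rule empirical_measure_prob_algebra)
    have "spread n k ?x = (\<integral>p. \<bar>(\<integral>x. f (Suc k) x \<partial>p) - (\<integral>x. f (Suc k) x \<partial>?e)\<bar> \<partial>post n ?x)" for k
      unfolding spread_def mean_def using integral_empirical_measure[OF \<omega>X n f_meas[of "Suc k"]] by simp
    then have r: "(\<lambda>k. (1 / 2) ^ Suc k * (\<integral>p. \<bar>(\<integral>x. f (Suc k) x \<partial>p) - (\<integral>x. f (Suc k) x \<partial>?e)\<bar> \<partial>post n ?x)) sums radius n ?x"
      using summable_sums[OF summable_spread[OF n x]] unfolding radius_def by simp
    show ?A
      using weak_dist_return_le[of ?T d g h "post n ?x" ?e "radius n ?x"] f_cont f_unit hk Q e r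
      unfolding f_def by simp
    show ?B
      using weak_dist_power_le[of X d g "post n ?x" ?e "radius n ?x" m] f_cont f_unit Q e r
      unfolding f_def by simp
  qed
  \<comment> \<open>Serves both assertions, with \<open>c = 1\<close> and \<open>c = m\<close>; the
    exceptional null set is the one of \<open>radius\<close>, whatever \<open>D\<close> and
    \<open>c\<close> are.\<close>
  have limsup: "AE \<omega> in \<rho>. limsup (\<lambda>n. ereal (sqrt (real n / ln (ln (real n))) * D n \<omega>)) \<le> ereal (sqrt 2 * c)"
    if D: "\<And>n \<omega>. n \<ge> 1 \<Longrightarrow> \<omega> \<in> space \<rho> \<Longrightarrow> D n \<omega> \<le> c * radius n (restrict \<omega> {..<n})" and "0 \<le> c"
    for D :: "nat \<Rightarrow> (nat \<Rightarrow> 'a) \<Rightarrow> real" and c :: real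
    using AE_normalized_radius_le AE_space
  proof eventually_elim
    case (elim \<omega>)
    have "filterlim (\<lambda>n::nat. ln (ln (real n))) at_top sequentially"
      by (intro filterlim_compose[OF ln_at_top] filterlim_real_sequentially)
    then have "eventually (\<lambda>n::nat. ln (ln (real n)) > 0) sequentially"
      by (rule eventually_compose_filterlim[OF eventually_gt_at_top])
    with elim(1) eventually_ge_at_top[of 1]
    have "eventually (\<lambda>n. ereal (sqrt (real n / ln (ln (real n))) * D n \<omega>) \<le> ereal (sqrt 2 * c)) sequentially"
    proof eventually_elim
      case (elim n)
      let ?s = "sqrt (real n / ln (ln (real n)))"
      have "?s * D n \<omega> \<le> ?s * (c * radius n (restrict \<omega> {..<n}))"
        using elim D[OF elim(2) \<open>\<omega> \<in> space \<rho>\<close>] by (intro mult_left_mono) auto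
      also have "\<dots> = c * (?s * radius n (restrict \<omega> {..<n}))" by simp
      also have "\<dots> \<le> c * sqrt 2" using elim(1) \<open>0 \<le> c\<close> by (rule mult_left_mono)
      finally show ?case by (simp add: mult.commute)
    qed
    then show ?case by (rule Limsup_bounded)
  qed
  show ?thesis
    using limsup[of "\<lambda>n \<omega>. weak_dist ?W ?wd h (post n (restrict \<omega> {..<n})) (return (borel_of ?W) (empirical_measure ?T n \<omega>))" 1]
      limsup[of "\<lambda>n \<omega>. weak_dist_power ?T d g m (iid_mixture ?T {..<m} (post n (restrict \<omega> {..<n})))
        (Pi\<^sub>M {..<m} (\<lambda>_. empirical_measure ?T n \<omega>))" "real m" for m]
      bounds by auto
qed

end
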